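(* Let $X$ be a compact well-ordered space whose limit capacity is a successor ordinal. Then the homeomorphism group $\mathrm{Homeo}(X)$, regarded as an abstract group, is SB-generated.
   Context: A well-ordered space is a well-ordered set with its order topology. For a space $X$, set $X^{(0)}=X$, $X^{(\alpha+1)}$ the set of accumulation points of $X^{(\alpha)}$, and $X^{(\lambda)}=\bigcap_{\alpha<\lambda}X^{(\alpha)}$ for limit $\lambda$; the Cantor--Bendixson rank is the least $\alpha$ with $X^{(\alpha+1)}=X^{(\alpha)}$. For a compact well-ordered space this rank is a successor ordinal, and its predecessor is called the limit capacity. A subset of a group $G$ is strongly bounded if it has finite diameter in every left-invariant metric on $G$; a group is SB-generated if generated by a strongly bounded subset. *)

theory Defs
  imports "HOL-Analysis.Analysis" "HOL-Algebra.Generated_Groups"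
begin

text \<open>Elements of a well-ordered index type stand for the ordinals below its order type.
  j is the immediate predecessor of i.\<close>
definition wo_succ :: "'i::wellorder \<Rightarrow> 'i \<Rightarrow> bool" where
  "wo_succ j i \<longleftrightarrow> j < i \<and> (\<forall>k. j < k \<longrightarrow> i \<le> k)"

text \<open>Cantor--Bendixson derivatives of the whole space, indexed by the well-order:
  X^(i) = accumulation points of X^(j) if i is the successor of j, and
  X^(i) = intersection of all X^(j), j < i, otherwise (this gives X at the least index).\<close>
definition cb_deriv_seq :: "('i::wellorder \<Rightarrow> 'a::topological_space set) \<Rightarrow> bool" where
  "cb_deriv_seq f \<longleftrightarrow>
     (\<forall>i. (\<forall>j. wo_succ j i \<longrightarrow> f i = {x. x islimpt f j}) \<and>
          ((\<nexists>j. wo_succ j i) \<longrightarrow> f i = (\<Inter>j\<in>{j. j < i}. f j)))"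

definition cb_rank_is :: "('i::wellorder \<Rightarrow> 'a::topological_space set) \<Rightarrow> 'i \<Rightarrow> bool" where
  "cb_rank_is f r \<longleftrightarrow>
     (\<exists>s. wo_succ r s \<and> f s = f r) \<and>
     (\<forall>a s. wo_succ a s \<and> f s = f a \<longrightarrow> r \<le> a)"

definition limit_capacity_is :: "('i::wellorder \<Rightarrow> 'a::topological_space set) \<Rightarrow> 'i \<Rightarrow> bool" where
  "limit_capacity_is f b \<longleftrightarrow> (\<exists>r. wo_succ b r \<and> cb_rank_is f r)"

definition left_invariant_metric :: "('g, 'b) monoid_scheme \<Rightarrow> ('g \<Rightarrow> 'g \<Rightarrow> real) \<Rightarrow> bool" where
  "left_invariant_metric G d \<longleftrightarrow>
     (\<forall>x\<in>carrier G. \<forall>y\<in>carrier G. d x y = 0 \<longleftrightarrow> x = y) \<and>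
     (\<forall>x\<in>carrier G. \<forall>y\<in>carrier G. d x y = d y x) \<and>
     (\<forall>x\<in>carrier G. \<forall>y\<in>carrier G. \<forall>z\<in>carrier G. d x z \<le> d x y + d y z) \<and>
     (\<forall>g\<in>carrier G. \<forall>x\<in>carrier G. \<forall>y\<in>carrier G. d (g \<otimes>\<^bsub>G\<^esub> x) (g \<otimes>\<^bsub>G\<^esub> y) = d x y)"

definition strongly_bounded :: "('g, 'b) monoid_scheme \<Rightarrow> 'g set \<Rightarrow> bool" where
  "strongly_bounded G A \<longleftrightarrow> A \<subseteq> carrier G \<and>
     (\<forall>d. left_invariant_metric G d \<longrightarrow> (\<exists>M. \<forall>x\<in>A. \<forall>y\<in>A. d x y \<le> M))"

definition SB_generated :: "('g, 'b) monoid_scheme \<Rightarrow> bool" where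
  "SB_generated G \<longleftrightarrow> (\<exists>A. strongly_bounded G A \<and> generate G A = carrier G)"

definition Homeo :: "('a::topological_space \<Rightarrow> 'a) monoid" where
  "Homeo = \<lparr> carrier = {h. \<exists>g. homeomorphism UNIV UNIV h g}, mult = (\<circ>), one = id \<rparr>"

end

theory Submission
  imports Defs
begin

text \<open>Let \<open>C\<close> be the derivative of \<open>X\<close> whose set \<open>E\<close> of accumulation points is the last nonempty
  derivative; \<open>E\<close> is finite. Comparability of well-orders shows that two clopen sets containing the
  same finite nonzero number of points of \<open>C\<close>, and none of \<open>E\<close>, are homeomorphic. Hence \<open>X\<close> splits
  into clopen sets \<open>Y e\<close>, \<open>e \<in> E\<close>, such that \<open>Y e - {e}\<close> is a disjoint union of a sequence of
  pairwise homeomorphic clopen pieces that converges to \<open>e\<close>; here the successor hypothesis enters.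

  A left-invariant metric amounts to a length function. An infinite swindle writes any sequence of
  homeomorphisms supported on an infinite, co-infinite union of pieces of \<open>Y e\<close> as words of linearly
  growing length in three fixed letters, so lengths are bounded there; every homeomorphism supported
  on \<open>Y e\<close> is a product of four such elements, up to inverses. Finally, Homeo(X) is generated by the
  homeomorphisms supported on a single \<open>Y e\<close> and finitely many further elements: representatives of
  the permutations induced on \<open>E\<close>, and shifts that move one piece from a fixed \<open>Y e0\<close> to another
  \<open>Y e\<close>.\<close>

section \<open>Homeomorphisms between open subsets\<close>

text \<open>Metrics on the abstract group need not respect any topology, so bounds can only come
  from counting letters in words. The letters may depend on the sequence being written: from a set
  of unbounded length one picks a sequence whose k-th length exceeds k^2, and words of length O(k)
  in letters fixed for that sequence give a contradiction. The swindle needs infinitely many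
  disjoint copies of the support, whereas an element of \<open>supported (Y e)\<close> may move
  every piece; hence the additional factorization. A homeomorphism fixing E pointwise need not
  preserve the sets \<open>Y e\<close>: it may carry finitely many pieces from one to another. The
  net transfer is an integer for each e, and homeomorphisms supported on single sets
  \<open>Y e\<close> cannot change it. Transfers through one fixed \<open>Y e0\<close> are enough to
  cancel it, so finitely many shifts suffice.\<close>

text \<open>For open S and T this is a homeomorphism in the subspace topologies, expressed through
  ambient open sets and a total function. No inverse has to be carried along, and values outside S
  are irrelevant, which keeps gluing simple.\<close>

definition open_homeo ::
    "'a::topological_space set \<Rightarrow> 'b::topological_space set \<Rightarrow> ('a \<Rightarrow> 'b) \<Rightarrow> bool" where
  "open_homeo S T h \<longleftrightarrow>
     open S \<and> open T \<and> bij_betw h S T \<and> (\<forall>U\<subseteq>S. open (h ` U) \<longleftrightarrow> open U)"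

lemma open_homeoD:
  assumes "open_homeo S T h"
  shows "open S" "open T" "bij_betw h S T" "inj_on h S" "h ` S = T"
    "\<And>U. U \<subseteq> S \<Longrightarrow> open (h ` U) \<longleftrightarrow> open U"
    "\<And>x. x \<in> S \<Longrightarrow> h x \<in> T"
  using assms unfolding open_homeo_def bij_betw_def by auto

lemma open_homeo_cong:
  assumes "open_homeo S T h" "\<And>x. x \<in> S \<Longrightarrow> h' x = h x"
  shows "open_homeo S T h'"
proof -
  have "h' ` U = h ` U" if "U \<subseteq> S" for U
    using assms(2) that by (intro image_cong) auto
  moreover have "bij_betw h' S T"
    using assms bij_betw_cong[of S h' h T] open_homeoD(3) by blast
  ultimately show ?thesis
    using assms(1) unfolding open_homeo_def by simp
qed

lemma open_homeo_id: "open S \<Longrightarrow> open_homeo S S id"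
  by (simp add: open_homeo_def)

lemma open_homeo_comp:
  assumes "open_homeo S T h" "open_homeo T R g"
  shows "open_homeo S R (g \<circ> h)"
proof -
  have "open ((g \<circ> h) ` U) \<longleftrightarrow> open U" if "U \<subseteq> S" for U
  proof -
    have "h ` U \<subseteq> T" using open_homeoD(5)[OF assms(1)] that by auto
    then show ?thesis
      using open_homeoD(6)[OF assms(1) that] open_homeoD(6)[OF assms(2)]
      by (metis image_comp)
  qed
  then show ?thesis
    using assms bij_betw_trans[of h S T g R] unfolding open_homeo_def by blast
qed

lemma open_homeo_inv:
  assumes "open_homeo S T h"
  shows "open_homeo T S (inv_into S h)"
proof -
  have "open (inv_into S h ` U) \<longleftrightarrow> open U" if "U \<subseteq> T" for U
  proof -
    have "inv_into S h ` U \<subseteq> S"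
      using that bij_betw_inv_into[OF open_homeoD(3)[OF assms]] unfolding bij_betw_def by blast
    moreover have "h ` (inv_into S h ` U) = U"
      using that open_homeoD(5)[OF assms] by (simp add: image_inv_into_cancel)
    ultimately show ?thesis
      using open_homeoD(6)[OF assms, of "inv_into S h ` U"] by simp
  qed
  then show ?thesis
    using assms bij_betw_inv_into[of h S T] unfolding open_homeo_def by blast
qed

lemma open_homeo_subset:
  assumes "open_homeo S T h" "U \<subseteq> S" "open U"
  shows "open_homeo U (h ` U) h"
  using assms unfolding open_homeo_def
  by (meson bij_betw_subset inj_on_imp_bij_betw bij_betw_imp_inj_on inj_on_subset subset_trans)

text \<open>Openness can be tested on the traces on the open sets \<open>S i\<close>. Disjointness
  of the targets gives injectivity and identifies the image of a trace with the trace of the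
  image.\<close>

lemma open_homeo_glue:
  assumes "\<And>i. i \<in> I \<Longrightarrow> open_homeo (S i) (T i) h"
    and "disjoint_family_on T I"
  shows "open_homeo (\<Union>i\<in>I. S i) (\<Union>i\<in>I. T i) h"
proof -
  have "bij_betw h (\<Union>i\<in>I. S i) (\<Union>i\<in>I. T i)"
    using assms(2) open_homeoD(3)[OF assms(1)] by (rule bij_betw_UNION_disjoint)
  moreover have "open (h ` U) \<longleftrightarrow> open U" if U: "U \<subseteq> (\<Union>i\<in>I. S i)" for U
  proof -
    have eq: "h ` (U \<inter> S i) = h ` U \<inter> T i" if i: "i \<in> I" for i
    proof
      show "h ` (U \<inter> S i) \<subseteq> h ` U \<inter> T i" using open_homeoD(5)[OF assms(1)[OF i]] by auto
    next
      show "h ` U \<inter> T i \<subseteq> h ` (U \<inter> S i)"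
      proof
        fix y assume y: "y \<in> h ` U \<inter> T i"
        then obtain x j where x: "x \<in> U" "y = h x" "j \<in> I" "x \<in> S j" using U by auto
        then have "y \<in> T j" using open_homeoD(7)[OF assms(1)] by blast
        then have "i = j"
          using y i x(3) assms(2) unfolding disjoint_family_on_def by blast
        then show "y \<in> h ` (U \<inter> S i)" using x by auto
      qed
    qed
    have 1: "U = (\<Union>i\<in>I. U \<inter> S i)" using U by auto
    have 2: "h ` U = (\<Union>i\<in>I. h ` (U \<inter> S i))" using 1 by blast
    have 3: "open (h ` (U \<inter> S i)) \<longleftrightarrow> open (U \<inter> S i)" if "i \<in> I" for i
      using open_homeoD(6)[OF assms(1)[OF that]] by simp
    show ?thesis
    proof
      assume "open (h ` U)"
      then have "open (U \<inter> S i)" if "i \<in> I" for i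
        using 3[OF that] eq[OF that] open_homeoD(2)[OF assms(1)[OF that]] by auto
      then show "open U" using 1 by (metis (no_types, lifting) open_UN)
    next
      assume "open U"
      then have "open (h ` (U \<inter> S i))" if "i \<in> I" for i
        using 3[OF that] open_homeoD(1)[OF assms(1)[OF that]] by auto
      then show "open (h ` U)" using 2 by (metis (no_types, lifting) open_UN)
    qed
  qed
  ultimately show ?thesis
    using open_homeoD(1,2)[OF assms(1)] unfolding open_homeo_def by blast
qed

lemma ex_open_homeo_glue:
  assumes "\<And>i. i \<in> I \<Longrightarrow> open_homeo (S i) (T i) (h i)"
    and "disjoint_family_on S I" "disjoint_family_on T I"
  obtains F where "open_homeo (\<Union>i\<in>I. S i) (\<Union>i\<in>I. T i) F"
    "\<And>i x. i \<in> I \<Longrightarrow> x \<in> S i \<Longrightarrow> F x = h i x"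
proof -
  define F where "F x = h (SOME i. i \<in> I \<and> x \<in> S i) x" for x
  have F: "F x = h i x" if "i \<in> I" "x \<in> S i" for i x
  proof -
    have "(SOME i. i \<in> I \<and> x \<in> S i) = i"
      using that assms(2) unfolding disjoint_family_on_def by (intro some_equality) blast+
    then show ?thesis by (simp add: F_def)
  qed
  have "open_homeo (\<Union>i\<in>I. S i) (\<Union>i\<in>I. T i) F"
    using assms(3) by (intro open_homeo_glue open_homeo_cong[OF assms(1) F]) auto
  then show ?thesis using F that by blast
qed

lemma open_homeo_Un:
  assumes "open_homeo S T h" "open_homeo S' T' h" "T \<inter> T' = {}"
  shows "open_homeo (S \<union> S') (T \<union> T') h"
proof -
  have "disjoint_family_on (\<lambda>b. if b then T else T') UNIV"
    using assms(3) by (auto simp: disjoint_family_on_def)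
  then have "open_homeo (\<Union>b. if b then S else S') (\<Union>b. if b then T else T') h"
    using assms by (intro open_homeo_glue) auto
  moreover have "(\<Union>b. if b then S else S') = S \<union> S'" "(\<Union>b. if b then T else T') = T \<union> T'"
    by (auto split: if_splits)
  ultimately show ?thesis by simp
qed

lemma ex_open_homeo_Un:
  assumes "open_homeo S T h" "open_homeo S' T' h'" "T \<inter> T' = {}" "S \<inter> S' = {}"
  shows "open_homeo (S \<union> S') (T \<union> T') (\<lambda>x. if x \<in> S then h x else h' x)"
  using assms(4) by (intro open_homeo_Un assms(3) open_homeo_cong[OF assms(1)]
      open_homeo_cong[OF assms(2)]) auto

lemma open_homeo_continuous_on:
  assumes "open_homeo S T h"
  shows "continuous_on S h"
proof -
  have "open (h -` B \<inter> S)" if "open B" for B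
  proof -
    have "h ` (h -` B \<inter> S) = B \<inter> T" using open_homeoD(5)[OF assms] by auto
    then show ?thesis
      using that open_homeoD(2,6)[OF assms] by (metis inf_le2 open_Int)
  qed
  then show ?thesis
    using open_homeoD(1)[OF assms] by (simp add: continuous_on_open_vimage)
qed

lemma homeomorphism_imp_open_homeo:
  assumes "homeomorphism S T f g" "open S" "open T"
  shows "open_homeo S T f"
proof -
  have bij: "bij_betw f S T"
    using assms(1) unfolding homeomorphism_def by (intro bij_betwI[where g = g]) auto
  have "open (f ` U) \<longleftrightarrow> open U" if U: "U \<subseteq> S" for U
  proof -
    have 1: "f ` U = g -` U \<inter> T"
      using assms(1) U unfolding homeomorphism_def by force
    have 2: "U = f -` (f ` U) \<inter> S"
      using bij U unfolding bij_betw_def inj_on_def by blast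
    show ?thesis
    proof
      assume "open (f ` U)"
      then have "open (f -` (f ` U) \<inter> S)"
        using assms unfolding homeomorphism_def by (simp add: continuous_on_open_vimage)
      then show "open U" using 2 by simp
    next
      assume "open U"
      then show "open (f ` U)"
        using assms 1 unfolding homeomorphism_def by (simp add: continuous_on_open_vimage)
    qed
  qed
  then show ?thesis using assms bij unfolding open_homeo_def by simp
qed

lemma carrier_Homeo_iff: "h \<in> carrier Homeo \<longleftrightarrow> open_homeo UNIV UNIV h"
proof
  assume "h \<in> carrier Homeo"
  then show "open_homeo UNIV UNIV h"
    by (auto simp: Homeo_def intro: homeomorphism_imp_open_homeo)
next
  assume h: "open_homeo UNIV UNIV h"
  have "homeomorphism UNIV UNIV h (inv_into UNIV h)"
    using open_homeo_continuous_on[OF h] open_homeo_continuous_on[OF open_homeo_inv[OF h]]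
      open_homeoD(3)[OF h]
    unfolding homeomorphism_def by (auto simp: bij_is_surj surj_f_inv_f bij_is_inj inj_imp_surj_inv)
  then show "h \<in> carrier Homeo" by (auto simp: Homeo_def)
qed

text \<open>Only neighbourhoods of e need an argument: the complement of one in the compact set
  \<open>insert e S\<close> is a compact subset of S, so its image is compact, hence closed. Thus
  infinitely many pieces converging to e can be moved independently, and continuity at e is
  automatic.\<close>

lemma open_homeo_insert_point:
  fixes S T :: "'a::t2_space set"
  assumes "compact (UNIV :: 'a set)" "open_homeo S T h"
    and "e \<notin> S" "e \<notin> T" "h e = e"
    and "open (insert e S)" "closed (insert e S)" "open (insert e T)" "closed (insert e T)"
  shows "open_homeo (insert e S) (insert e T) h"
proof -
  have comp: "compact A" if "closed A" for A :: "'a set"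
    using that compact_Int_closed[OF assms(1)] by simp
  \<comment> \<open>Stated for arbitrary f, S and T, because it is applied to h and, with the roles
    exchanged, to its inverse.\<close>
  have *: "open (f ` U)"
    if f: "open_homeo S T f" "f e = e" "e \<notin> S" "e \<notin> T" "closed (insert e S)" "open (insert e T)"
      and U: "U \<subseteq> insert e S" "open U" "e \<in> U" for f U and S T :: "'a set"
  proof -
    have "compact (insert e S - U)" using f U by (intro comp closed_Diff) auto
    moreover have "insert e S - U \<subseteq> S" using U by auto
    ultimately have "compact (f ` (insert e S - U))"
      using open_homeo_continuous_on[OF f(1)] compact_continuous_image continuous_on_subset by blast
    then have "open (insert e T - f ` (insert e S - U))"
      using f compact_imp_closed by blast
    moreover have "insert e T - f ` (insert e S - U) = f ` U"
    proof -
      have "f ` insert e S = insert e T" "inj_on f (insert e S)"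
        using open_homeoD(4,5)[OF f(1)] f(2-4) by (auto simp: inj_on_def)
      then show ?thesis using U(1)
        by (metis double_diff inj_on_image_set_diff subset_refl Diff_subset)
    qed
    ultimately show ?thesis by simp
  qed
  have inj: "inj_on h (insert e S)" and im: "h ` insert e S = insert e T"
    using open_homeoD(4,5)[OF assms(2)] assms(3-5) by (auto simp: inj_on_def)
  have "open (h ` U) \<longleftrightarrow> open U" if U: "U \<subseteq> insert e S" for U
  proof (cases "e \<in> U")
    case False
    then show ?thesis using U open_homeoD(6)[OF assms(2), of U] by (metis subset_insert)
  next
    case True
    define g where "g = inv_into (insert e S) h"
    have g: "open_homeo T S g"
    proof (rule open_homeo_cong[OF open_homeo_inv[OF assms(2)]])
      fix x assume "x \<in> T"
      then obtain y where y: "y \<in> S" "x = h y" using open_homeoD(5)[OF assms(2)] by auto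
      then show "g x = inv_into S h x"
        using inj open_homeoD(4)[OF assms(2)] by (simp add: g_def)
    qed
    have ge: "g e = e" using inj inv_into_f_f[of h "insert e S" e] assms(5) by (simp add: g_def)
    have gU: "g ` (h ` U) = U" using inj U unfolding g_def
      by (simp add: inv_into_image_cancel)
    have hU: "h ` U \<subseteq> insert e T" "e \<in> h ` U" using U im True assms(5) by (auto intro!: image_eqI[of e h e])
    show ?thesis
      using *[OF assms(2,5,3,4,7,8) U] *[OF g ge assms(4,3,9,6) hU(1)] hU(2) gU True by auto
  qed
  then show ?thesis
    using inj im assms unfolding open_homeo_def bij_betw_def by simp
qed

section \<open>Invariance of the derivatives\<close>

lemma islimpt_open_homeo_image:
  assumes h: "open_homeo S T h" and x: "x \<in> S" "x islimpt A"
  shows "h x islimpt (h ` (S \<inter> A))"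
proof (rule islimptI)
  fix U assume U: "h x \<in> U" "open U"
  define V where "V = h -` U \<inter> S"
  have "open V" using U open_homeo_continuous_on[OF h] open_homeoD(1)[OF h]
    by (simp add: V_def continuous_on_open_vimage)
  moreover have "x \<in> V" using x U by (simp add: V_def)
  ultimately obtain y where y: "y \<in> A" "y \<in> V" "y \<noteq> x"
    using x(2) by (meson islimptE)
  then show "\<exists>y\<in>h ` (S \<inter> A). y \<in> U \<and> y \<noteq> h x"
    using x(1) open_homeoD(4)[OF h] by (intro bexI[of _ "h y"]) (auto simp: V_def inj_on_def)
qed

text \<open>Being a limit point is a local property, so transfinite induction works for maps between
  open subsets. Global homeomorphisms would not be enough: clopen subsets are compared below by
  order isomorphisms defined only on them.\<close>

lemma open_homeo_cb_deriv_subset: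
  fixes f :: "'i::wellorder \<Rightarrow> 'a::topological_space set"
  assumes "cb_deriv_seq f"
  shows "open_homeo S T h \<Longrightarrow> h ` (S \<inter> f i) \<subseteq> f i"
proof (induction i rule: less_induct)
  case (less i)
  show ?case
  proof (cases "\<exists>j. wo_succ j i")
    case True
    then obtain j where j: "wo_succ j i" by blast
    then have fi: "f i = {x. x islimpt f j}" and "j < i"
      using assms unfolding cb_deriv_seq_def wo_succ_def by blast+
    show ?thesis
    proof safe
      fix x assume x: "x \<in> S" "x \<in> f i"
      then have "h x islimpt (h ` (S \<inter> f j))"
        using islimpt_open_homeo_image[OF less.prems] fi by simp
      then show "h x \<in> f i"
        using less.IH[OF \<open>j < i\<close> less.prems] islimpt_subset fi by blast
    qed
  next
    case False
    then have fi: "f i = (\<Inter>j\<in>{j. j < i}. f j)"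
      using assms unfolding cb_deriv_seq_def by blast
    show ?thesis using less.IH[OF _ less.prems] unfolding fi by blast
  qed
qed

lemma open_homeo_cb_deriv:
  assumes "cb_deriv_seq f" "open_homeo S T h" "x \<in> S"
  shows "h x \<in> f i \<longleftrightarrow> x \<in> f i"
proof
  assume "x \<in> f i"
  then show "h x \<in> f i" using open_homeo_cb_deriv_subset[OF assms(1,2)] assms(3) by blast
next
  assume hx: "h x \<in> f i"
  have "inv_into S h (h x) \<in> f i"
    using open_homeo_cb_deriv_subset[OF assms(1) open_homeo_inv[OF assms(2)]] hx
      open_homeoD(7)[OF assms(2,3)] by blast
  then show "x \<in> f i" using assms open_homeoD(4) by (metis inv_into_f_f)
qed

section \<open>Compact well-ordered spaces\<close>

text \<open>Every non-maximal element has an immediate successor, so closed initial segments are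
  also open. Clopen sets are cut along such segments throughout.\<close>

lemma open_atMost_wellorder:
  fixes x :: "'a::{wellorder, linorder_topology}"
  shows "open {..x}"
proof (cases "\<exists>y. x < y")
  case True
  define s where "s = (LEAST y. x < y)"
  have "{..x} = {..<s}"
  proof -
    have "x < s" using True LeastI_ex[of "\<lambda>y. x < y"] by (simp add: s_def)
    moreover have "s \<le> y" if "x < y" for y using that by (simp add: s_def Least_le)
    ultimately show ?thesis by (auto simp: not_less[symmetric])
  qed
  then show ?thesis by simp
next
  case False
  then have "{..x} = UNIV" by (auto simp: not_less)
  then show ?thesis by simp
qed

text \<open>Comparability of well-orders, translated from the relational form: \<open>embed\<close>
  means that f is an isomorphism onto an initial segment.\<close>

lemma wellorder_sets_comparable:
  fixes A B :: "'a::wellorder set"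
  obtains (left) f where "strict_mono_on A f" "f ` A \<subseteq> B" "\<forall>x\<in>A. \<forall>y\<in>B. y \<le> f x \<longrightarrow> y \<in> f ` A"
  | (right) f where "strict_mono_on B f" "f ` B \<subseteq> A" "\<forall>x\<in>B. \<forall>y\<in>A. y \<le> f x \<longrightarrow> y \<in> f ` B"
proof -
  define r :: "'a set \<Rightarrow> ('a \<times> 'a) set" where "r A = {(x, y). x \<in> A \<and> y \<in> A \<and> x \<le> y}" for A
  have Fr: "Field (r A) = A" for A by (auto simp: r_def Field_def)
  have under: "under (r A) a = {x \<in> A. x \<le> a}" if "a \<in> A" for A a
    using that by (auto simp: r_def under_def)
  have wo: "Well_order (r A)" for A
  proof -
    have "wf (r A - Id)"
      by (rule wf_subset[OF wellorder_class.wf]) (auto simp: r_def)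
    then show ?thesis
      by (auto simp: well_order_on_def linear_order_on_def partial_order_on_def preorder_on_def Fr
          refl_on_def trans_def antisym_def total_on_def) (auto simp: r_def)
  qed
  have key: "strict_mono_on A f \<and> f ` A \<subseteq> B \<and> (\<forall>x\<in>A. \<forall>y\<in>B. y \<le> f x \<longrightarrow> y \<in> f ` A)"
    if e: "embed (r A) (r B) f" for A B f
  proof -
    have sub: "f ` A \<subseteq> B" using embed_Field[OF e] by (simp add: Fr)
    have inj: "inj_on f A" using embed_inj_on[OF wo e] by (simp add: Fr)
    have comp: "compat (r A) (r B) f" using embed_compat[OF e] .
    have bij: "bij_betw f {x \<in> A. x \<le> a} {x \<in> B. x \<le> f a}" if "a \<in> A" for a
    proof -
      have "f a \<in> B" using that sub by blast
      then show ?thesis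
        using e that under[OF that] under[of "f a" B] unfolding embed_def Fr by metis
    qed
    have "strict_mono_on A f"
    proof (rule strict_mono_onI)
      fix x y assume "x \<in> A" "y \<in> A" "x < y"
      moreover then have "f x \<le> f y" using comp by (auto simp: compat_def r_def)
      ultimately show "f x < f y" using inj by (metis inj_onD order_le_less order_less_irrefl)
    qed
    moreover have "y \<in> f ` A" if "x \<in> A" "y \<in> B" "y \<le> f x" for x y
      using bij[OF that(1)] that unfolding bij_betw_def by (metis (mono_tags, lifting) imageE image_eqI mem_Collect_eq)
    ultimately show ?thesis using sub by blast
  qed
  show ?thesis
    using wellorders_totally_ordered[OF wo[of A] wo[of B]] key left right by (metis (no_types, lifting))
qed

text \<open>An increasing map on a subset of a well-order fails to be continuous only by skipping a
  supremum, and a compact image contains its suprema. For the lower bound, the largest value up to a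
  gives the cut; for the upper bound, the first argument whose value reaches b.\<close>

lemma continuous_on_strict_mono_onto_compact:
  fixes f :: "'a::{wellorder, linorder_topology} \<Rightarrow> 'a"
  assumes "strict_mono_on A f" "compact (f ` A)"
  shows "continuous_on A f"
proof -
  have less: "f x < f y \<longleftrightarrow> x < y" if "x \<in> A" "y \<in> A" for x y
    using assms(1) that by (metis linorder_neqE order_less_asym order_less_irrefl strict_mono_onD)
  show ?thesis
    unfolding continuous_on_def
  proof (intro ballI order_tendstoI)
    fix z a assume z: "z \<in> A" "a < f z"
    have c: "compact (f ` A \<inter> {..a})" using assms(2) by (intro compact_Int_closed) auto
    show "\<forall>\<^sub>F x in at z within A. a < f x"
    proof (cases "f ` A \<inter> {..a} = {}")
      case True
      then show ?thesis by (auto simp: eventually_at_filter disjoint_iff not_le)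
    next
      case False
      then obtain v where v: "v \<in> f ` A" "v \<le> a" "\<And>w. w \<in> f ` A \<Longrightarrow> w \<le> a \<Longrightarrow> w \<le> v"
        using compact_attains_sup[OF c] by auto
      then obtain u where u: "u \<in> A" "v = f u" by auto
      have "u < z" using less[OF u(1) z(1)] v(2) z(2) u(2) by (metis order.strict_trans1)
      then have "\<forall>\<^sub>F x in nhds z. u < x" by (intro eventually_nhds_in_open[of "{u<..}", simplified]) auto
      then show ?thesis
        unfolding eventually_at_filter
      proof eventually_elim
        case (elim x)
        then show ?case using less[OF u(1), of x] v(3)[of "f x"] u(2) by (auto simp: not_le[symmetric])
      qed
    qed
  next
    fix z b assume z: "z \<in> A" "f z < b"
    show "\<forall>\<^sub>F x in at z within A. f x < b"
    proof (cases "\<exists>u\<in>A. b \<le> f u")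
      case False
      then show ?thesis by (auto simp: eventually_at_filter not_le)
    next
      case True
      define u where "u = (LEAST u. u \<in> A \<and> b \<le> f u)"
      have u: "u \<in> A" "b \<le> f u" "\<And>w. w \<in> A \<Longrightarrow> b \<le> f w \<Longrightarrow> u \<le> w"
        using True LeastI[of "\<lambda>u. u \<in> A \<and> b \<le> f u"] Least_le[of "\<lambda>u. u \<in> A \<and> b \<le> f u"]
        unfolding u_def by blast+
      have "z < u" using less[OF z(1) u(1)] u(2) z(2) by (metis order.strict_trans2)
      then have "\<forall>\<^sub>F x in nhds z. x < u" by (intro eventually_nhds_in_open[of "{..<u}", simplified]) auto
      then show ?thesis
        unfolding eventually_at_filter
      proof eventually_elim
        case (elim x)
        then show ?case using u(3)[of x] by (auto simp: not_le[symmetric])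
      qed
    qed
  qed
qed

lemma open_homeo_strict_mono:
  fixes f :: "'a::{wellorder, linorder_topology} \<Rightarrow> 'a"
  assumes "strict_mono_on A f" "compact A" "open A" "compact (f ` A)" "open (f ` A)"
  shows "open_homeo A (f ` A) f"
proof -
  have inj: "inj_on f A" using assms(1) by (rule strict_mono_on_imp_inj_on)
  have less: "f x < f y \<longleftrightarrow> x < y" if "x \<in> A" "y \<in> A" for x y
    using assms(1) that by (metis linorder_neqE order_less_asym order_less_irrefl strict_mono_onD)
  have im: "inv_into A f ` f ` A = A" using inj by (simp add: inv_into_image_cancel)
  have "strict_mono_on (f ` A) (inv_into A f)"
    using inj less by (auto intro!: strict_mono_onI)
  then have "continuous_on (f ` A) (inv_into A f)"
    using assms(2) im by (intro continuous_on_strict_mono_onto_compact) auto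
  moreover have "continuous_on A f"
    using assms by (intro continuous_on_strict_mono_onto_compact) auto
  ultimately have "homeomorphism A (f ` A) f (inv_into A f)"
    using inj im unfolding homeomorphism_def by auto
  then show ?thesis using assms by (intro homeomorphism_imp_open_homeo) auto
qed

lemma clopen_atMost:
  fixes z :: "'a::{wellorder, linorder_topology}"
  assumes "open Z" "closed Z"
  shows "open (Z \<inter> {..z})" "closed (Z \<inter> {..z})" "open (Z - {..z})" "closed (Z - {..z})"
  using assms open_atMost_wellorder by auto

text \<open>The largest element of A makes the image the cut of B at \<open>f a\<close>, which is
  clopen; a general initial segment of B need not be closed.\<close>

lemma open_homeo_initial_segment:
  fixes f :: "'a::{wellorder, linorder_topology} \<Rightarrow> 'a"
  assumes "compact (UNIV :: 'a set)" "strict_mono_on A f" "open A" "closed A" "open B" "closed B"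
    and "f ` A \<subseteq> B" "\<forall>x\<in>A. \<forall>y\<in>B. y \<le> f x \<longrightarrow> y \<in> f ` A"
    and "a \<in> A" "\<forall>x\<in>A. x \<le> a"
  shows "open_homeo A (B \<inter> {..f a}) f"
proof -
  have im: "f ` A = B \<inter> {..f a}"
  proof
    show "f ` A \<subseteq> B \<inter> {..f a}"
      using assms(7,9,10) strict_mono_on_leD[OF assms(2)] by auto
    show "B \<inter> {..f a} \<subseteq> f ` A" using assms(8,9) by auto
  qed
  have comp: "compact Z" if "closed Z" for Z :: "'a set"
    using that compact_Int_closed[OF assms(1)] by simp
  have "open_homeo A (f ` A) f"
    using assms(2-6) open_atMost_wellorder[of "f a"]
    by (intro open_homeo_strict_mono comp) (auto simp: im)
  then show ?thesis by (simp add: im)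
qed

section \<open>Counting points of C classifies clopen sets\<close>

context
  fixes C :: "'a::{wellorder, linorder_topology} set"
  assumes compact_UNIV: "compact (UNIV :: 'a set)"
    and C_invariant: "\<And>S T h x. open_homeo S T h \<Longrightarrow> x \<in> S \<Longrightarrow> h x \<in> C \<longleftrightarrow> x \<in> C"
begin

text \<open>If one of the two well-ordered sets were isomorphic to a proper initial segment of the
  other, the isomorphism would carry the largest point to a second point of C.\<close>
lemma ex_open_homeo_Max:
  assumes "open Z" "closed Z" "Z \<inter> C = {z}" "\<forall>x\<in>Z. x \<le> z"
    and "open Z'" "closed Z'" "Z' \<inter> C = {z'}" "\<forall>x\<in>Z'. x \<le> z'"
  shows "\<exists>h. open_homeo Z Z' h"
proof -
  have *: "open_homeo A B f"
    if "strict_mono_on A f" "f ` A \<subseteq> B" "\<forall>x\<in>A. \<forall>y\<in>B. y \<le> f x \<longrightarrow> y \<in> f ` A"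
      and "open A" "closed A" "A \<inter> C = {a}" "\<forall>x\<in>A. x \<le> a"
      and "open B" "closed B" "B \<inter> C = {b}" "\<forall>x\<in>B. x \<le> b" for A B f a b
  proof -
    have a: "a \<in> A" "a \<in> C" using that(6) by auto
    have h: "open_homeo A (B \<inter> {..f a}) f"
      by (rule open_homeo_initial_segment[OF compact_UNIV that(1,4,5,8,9,2,3) a(1) that(7)])
    have "f a \<in> C" using C_invariant[OF h a(1)] a(2) by simp
    then have "f a = b" using that(2,10) a(1) by blast
    then have "B \<inter> {..f a} = B" using that(11) by auto
    then show ?thesis using h by simp
  qed
  show ?thesis
  proof (cases rule: wellorder_sets_comparable[of Z Z'])
    case (left f)
    show ?thesis using *[OF left assms] by blast
  next
    case (right f)
    show ?thesis using open_homeo_inv[OF *[OF right assms(5-8,1-4)]] by blast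
  qed
qed

text \<open>The part above z contains no point of C and is absorbed by the part up to z, as in the
  ordinal identity \<beta> + \<omega>^\<alpha> = \<omega>^\<alpha> for \<beta> < \<omega>^\<alpha>:
  it is isomorphic to an initial segment of the lower part, and what remains of the lower part after
  removing that segment is again homeomorphic to the whole lower part.\<close>

lemma ex_open_homeo_below:
  assumes Z: "open Z" "closed Z" "Z \<inter> C = {z}"
  shows "\<exists>h. open_homeo Z (Z \<inter> {..z}) h"
proof -
  define Z1 where "Z1 = Z \<inter> {..z}"
  define Z2 where "Z2 = Z - {..z}"
  have cl1: "open Z1" "closed Z1" and cl2: "open Z2" "closed Z2"
    using Z open_atMost_wellorder by (auto simp: Z1_def Z2_def)
  have un: "Z1 \<union> Z2 = Z" by (auto simp: Z1_def Z2_def)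
  have zC: "z \<in> C" "z \<in> Z1" using Z by (auto simp: Z1_def)
  have Z1C: "Z1 \<inter> C = {z}" using Z(3) zC by (auto simp: Z1_def)
  have Z2C: "Z2 \<inter> C = {}" using Z(3) by (auto simp: Z2_def)
  have Z1z: "\<forall>x\<in>Z1. x \<le> z" by (auto simp: Z1_def)
  show ?thesis
  proof (cases "Z2 = {}")
    case True
    then have "Z = Z \<inter> {..z}" using un by (auto simp: Z1_def)
    then show ?thesis using open_homeo_id[OF Z(1)] by metis
  next
    case False
    have "compact Z2" using cl2 compact_Int_closed[OF compact_UNIV] by simp
    then obtain m where m: "m \<in> Z2" "\<forall>x\<in>Z2. x \<le> m"
      using compact_attains_sup False by metis
    show ?thesis
    proof (cases rule: wellorder_sets_comparable[of Z2 Z1])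
      case (left f)
      define w where "w = f m"
      have f: "open_homeo Z2 (Z1 \<inter> {..w}) f"
        unfolding w_def using open_homeo_initial_segment[OF compact_UNIV left(1) cl2 cl1 left(2,3) m] .
      have "w \<in> Z1" using left(2) m(1) by (auto simp: w_def)
      moreover have "w \<notin> C" using C_invariant[OF f m(1)] Z2C m(1) by (auto simp: w_def)
      \<comment> \<open>The strict inequality keeps z in the remainder, which therefore has z as its
        only point of C and as its maximum.\<close>
      ultimately have "w < z" using Z1z zC by (metis order_le_less)
      then have "(Z1 - {..w}) \<inter> C = {z}" using Z1C zC by auto
      then obtain g where g: "open_homeo Z1 (Z1 - {..w}) g"
        using ex_open_homeo_Max[OF cl1 Z1C Z1z, of "Z1 - {..w}" z] Z1z
          clopen_atMost[OF cl1]
        by auto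
      have "open_homeo (Z1 \<union> Z2) ((Z1 - {..w}) \<union> (Z1 \<inter> {..w})) (\<lambda>x. if x \<in> Z1 then g x else f x)"
        by (rule ex_open_homeo_Un[OF g f]) (auto simp: Z1_def Z2_def)
      moreover have "(Z1 - {..w}) \<union> (Z1 \<inter> {..w}) = Z1" by auto
      ultimately show ?thesis using un unfolding Z1_def by auto
    next
      case (right f)
      have f: "open_homeo Z1 (Z2 \<inter> {..f z}) f"
        using open_homeo_initial_segment[OF compact_UNIV right(1) cl1 cl2 right(2,3) zC(2) Z1z] .
      \<comment> \<open>The opposite comparison is impossible, since it would put a point of C above
        z.\<close>
      have "f z \<in> C" using C_invariant[OF f zC(2)] zC by simp
      moreover have "f z \<in> Z2" using right(2) zC by auto
      ultimately show ?thesis using Z2C by auto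
    qed
  qed
qed

lemma ex_open_homeo_single:
  assumes "open Z" "closed Z" "Z \<inter> C = {z}" "open Z'" "closed Z'" "Z' \<inter> C = {z'}"
  shows "\<exists>h. open_homeo Z Z' h"
proof -
  obtain g where g: "open_homeo Z (Z \<inter> {..z}) g"
    using ex_open_homeo_below assms by blast
  obtain g' where g': "open_homeo Z' (Z' \<inter> {..z'}) g'"
    using ex_open_homeo_below assms by blast
  have "(Z \<inter> {..z}) \<inter> C = {z}" "(Z' \<inter> {..z'}) \<inter> C = {z'}" using assms by auto
  then obtain k where "open_homeo (Z \<inter> {..z}) (Z' \<inter> {..z'}) k"
    using ex_open_homeo_Max[of "Z \<inter> {..z}" z "Z' \<inter> {..z'}" z']
      clopen_atMost[OF assms(1,2)] clopen_atMost[OF assms(4,5)]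
    by auto
  then show ?thesis using open_homeo_comp[OF open_homeo_comp[OF g] open_homeo_inv[OF g']] by blast
qed

text \<open>Cutting at the least point of C splits off a set with exactly one such point and leaves
  one point fewer. At least one point is required because clopen sets that miss C need not be
  homeomorphic.\<close>

lemma ex_open_homeo_card:
  assumes "open Z" "closed Z" "open Z'" "closed Z'"
    and "finite (Z \<inter> C)" "Z \<inter> C \<noteq> {}" "card (Z' \<inter> C) = card (Z \<inter> C)"
  shows "\<exists>h. open_homeo Z Z' h"
  using assms
proof (induction "card (Z \<inter> C)" arbitrary: Z Z')
  case 0
  then show ?case by auto
next
  case (Suc n)
  show ?case
  \<comment> \<open>The recursion ends at one point rather than none: the remainder must still meet
    C for the induction hypothesis to apply.\<close>
  proof (cases "n = 0")
    case True
    then show ?thesis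
      using Suc.hyps(2) Suc.prems ex_open_homeo_single by (metis One_nat_def card_1_singletonE)
  next
    case False
    have split: "\<exists>z. (A \<inter> {..z}) \<inter> C = {z} \<and> card ((A - {..z}) \<inter> C) = n \<and> finite ((A - {..z}) \<inter> C)"
      if "card (A \<inter> C) = Suc n" for A
    proof -
      have fin: "finite (A \<inter> C)" "A \<inter> C \<noteq> {}" using that by (auto intro: card_ge_0_finite)
      define z where "z = Min (A \<inter> C)"
      have z: "z \<in> A \<inter> C" "\<And>x. x \<in> A \<inter> C \<Longrightarrow> z \<le> x"
        using Min_in[OF fin] Min_le[OF fin(1)] by (auto simp only: z_def)
      have "(A \<inter> {..z}) \<inter> C = {z}" using z by (auto intro: antisym)
      moreover have "(A - {..z}) \<inter> C = A \<inter> C - {z}" using z by (fastforce simp: not_le)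
      ultimately show ?thesis using that fin z by (intro exI[of _ z]) auto
    qed
    obtain z where z: "(Z \<inter> {..z}) \<inter> C = {z}" "card ((Z - {..z}) \<inter> C) = n" "finite ((Z - {..z}) \<inter> C)"
      using split[of Z] Suc.hyps by metis
    obtain z' where z': "(Z' \<inter> {..z'}) \<inter> C = {z'}" "card ((Z' - {..z'}) \<inter> C) = n"
      using split[of Z'] Suc.hyps Suc.prems by metis
    obtain g where g: "open_homeo (Z \<inter> {..z}) (Z' \<inter> {..z'}) g"
      using ex_open_homeo_single[OF _ _ z(1) _ _ z'(1)] clopen_atMost Suc.prems(1-4) by metis
    have "(Z - {..z}) \<inter> C \<noteq> {}" using z(2) False by (metis card.empty)
    then obtain h where h: "open_homeo (Z - {..z}) (Z' - {..z'}) h"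
      using Suc.hyps(1)[of "Z - {..z}" "Z' - {..z'}"] z(2,3) z'(2) clopen_atMost Suc.prems(1-4) by metis
    have "open_homeo ((Z \<inter> {..z}) \<union> (Z - {..z})) ((Z' \<inter> {..z'}) \<union> (Z' - {..z'}))
            (\<lambda>x. if x \<in> Z \<inter> {..z} then g x else h x)"
      by (rule ex_open_homeo_Un[OF g h]) auto
    then show ?thesis by (auto simp: Int_Diff_Un)
  qed
qed

end

section \<open>Partitions by rounding up\<close>

text \<open>Rounds up to the next element of M. Arguments above all of M get the default m, so for m
  in M this is a retraction onto M whose fibres are the stretches between consecutive elements, the
  final stretch being added to the fibre of m.\<close>

definition ceil_in :: "'a::wellorder set \<Rightarrow> 'a \<Rightarrow> 'a \<Rightarrow> 'a" where
  "ceil_in M m d = (if \<exists>x\<in>M. d \<le> x then LEAST x. x \<in> M \<and> d \<le> x else m)"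

lemma ceil_in_ge:
  assumes "x \<in> M" "d \<le> x"
  shows "ceil_in M m d \<in> M" "d \<le> ceil_in M m d" "ceil_in M m d \<le> x"
  using assms LeastI[of "\<lambda>x. x \<in> M \<and> d \<le> x" x] Least_le[of "\<lambda>x. x \<in> M \<and> d \<le> x" x]
  unfolding ceil_in_def by auto

lemma ceil_in_mem: "m \<in> M \<Longrightarrow> ceil_in M m d \<in> M"
  using ceil_in_ge(1)[of _ M d m] by (metis ceil_in_def)

lemma ceil_in_self: "x \<in> M \<Longrightarrow> ceil_in M m x = x"
  using ceil_in_ge[of x M x m] by auto

text \<open>Some neighbourhood of d contains no element of M except possibly d, and as
  \<open>{..d}\<close> is open it may be taken below d. Its points then have the same upper bounds
  in M as d.\<close>

lemma ceil_in_locally_constant: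
  fixes d :: "'a::{wellorder, linorder_topology}"
  assumes "\<not> d islimpt M"
  shows "\<exists>U. open U \<and> d \<in> U \<and> (\<forall>x\<in>U. ceil_in M m x = ceil_in M m d)"
proof -
  obtain U where U: "open U" "d \<in> U" "\<And>y. y \<in> M \<Longrightarrow> y \<in> U \<Longrightarrow> y = d"
    using assms unfolding islimpt_def by blast
  obtain V where V: "open V" "d \<in> V" "\<And>x y. x \<in> V \<Longrightarrow> x \<le> y \<Longrightarrow> y \<le> d \<Longrightarrow> y \<in> U" "V \<subseteq> {..d}"
  proof (cases "\<exists>w. w < d")
    case True
    then obtain w where "w < d" "{w<..d} \<subseteq> U" using open_left[OF U(1,2)] by blast
    moreover have "open ({w<..} \<inter> {..d})" using open_atMost_wellorder by (intro open_Int) auto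
    ultimately show ?thesis by (intro that[of "{w<..} \<inter> {..d}"]) auto
  next
    case False
    then have "{..d} = {d}" by (auto simp: not_less intro: antisym)
    then show ?thesis using U(2) open_atMost_wellorder[of d] by (intro that[of "{d}"]) auto
  qed
  have same: "x \<le> y \<longleftrightarrow> d \<le> y" if "x \<in> V" "y \<in> M" for x y
    using V(3)[OF that(1), of y] V(4) that U(3)[of y] by fastforce
  have "ceil_in M m x = ceil_in M m d" if "x \<in> V" for x
  proof -
    have "(\<lambda>y. y \<in> M \<and> x \<le> y) = (\<lambda>y. y \<in> M \<and> d \<le> y)"
      using same[OF that] by auto
    moreover have "(\<exists>y\<in>M. x \<le> y) \<longleftrightarrow> (\<exists>y\<in>M. d \<le> y)"
      using same[OF that] by auto
    ultimately show ?thesis unfolding ceil_in_def by simp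
  qed
  then show ?thesis using V by blast
qed

lemma finite_no_limpt:
  fixes C :: "'a::topological_space set"
  assumes "compact (UNIV :: 'a set)" "closed Z" "\<And>x. x \<in> Z \<Longrightarrow> \<not> x islimpt C"
  shows "finite (Z \<inter> C)"
proof (rule ccontr)
  assume "infinite (Z \<inter> C)"
  moreover have "compact Z" using assms compact_Int_closed by (metis inf_top_left)
  ultimately obtain x where "x \<in> Z" "x islimpt (Z \<inter> C)"
    using Heine_Borel_imp_Bolzano_Weierstrass by blast
  then show False using assms(3) islimpt_subset by blast
qed

text \<open>The pieces are the fibres of rounding up to N, the points of C in Y other than e. Each
  point of N below e has finitely many predecessors in N, and N is finite above e, so N can be
  enumerated. No fibre accumulates at e, because N is cofinal below e.\<close>

lemma ex_piece_sequence:
  fixes C Y :: "'a::{wellorder, linorder_topology} set"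
  assumes comp: "compact (UNIV :: 'a set)"
    and Y: "open Y" "closed Y" "e \<in> Y" "e islimpt C"
    and lim: "\<And>x. x \<in> Y \<Longrightarrow> x islimpt C \<Longrightarrow> x = e"
  shows "\<exists>K :: nat \<Rightarrow> 'a set. (\<forall>k. open (K k) \<and> closed (K k) \<and> (\<exists>x. K k \<inter> C = {x})) \<and>
           disjoint_family K \<and> (\<Union>k. K k) = Y - {e}"
proof -
  define N where "N = C \<inter> Y - {e}"
  have cofinal: "\<exists>x\<in>N. d < x \<and> x < e" if "d < e" for d
  proof -
    have "open (Y \<inter> {d<..} \<inter> {..e})" using Y open_atMost_wellorder by (intro open_Int) auto
    moreover have "e \<in> Y \<inter> {d<..} \<inter> {..e}" using Y that by auto
    ultimately obtain x where "x \<in> C" "x \<in> Y \<inter> {d<..} \<inter> {..e}" "x \<noteq> e"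
      using Y(4) by (metis islimptE)
    then show ?thesis by (intro bexI[of _ x]) (auto simp: N_def)
  qed
  have "e islimpt (N \<inter> {..<e})"
  proof (rule islimptI)
    fix T assume T: "e \<in> T" "open T"
    then have "open (Y \<inter> T \<inter> {..e})" "e \<in> Y \<inter> T \<inter> {..e}"
      using Y open_atMost_wellorder by auto
    then obtain x where "x \<in> C" "x \<in> Y \<inter> T \<inter> {..e}" "x \<noteq> e"
      using Y(4) by (metis islimptE)
    then show "\<exists>y\<in>N \<inter> {..<e}. y \<in> T \<and> y \<noteq> e" by (intro bexI[of _ x]) (auto simp: N_def)
  qed
  then have inf: "infinite (N \<inter> {..<e})" using islimpt_finite by blast
  then obtain x0 where x0: "x0 \<in> N" "x0 < e" by (metis Int_iff finite.emptyI equals0I lessThan_iff)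
  have fin_below: "finite (N \<inter> {..<z})" if "z < e" for z
  proof -
    have "finite ((Y \<inter> {..z}) \<inter> C)"
    proof (rule finite_no_limpt[OF comp])
      show "closed (Y \<inter> {..z})" using Y by auto
      show "\<not> x islimpt C" if "x \<in> Y \<inter> {..z}" for x
        using lim[of x] that \<open>z < e\<close> by auto
    qed
    then show ?thesis by (rule finite_subset[rotated]) (auto simp: N_def)
  qed
  have "inj_on (\<lambda>z. card (N \<inter> {..<z})) (N \<inter> {..<e})"
  proof (rule strict_mono_on_imp_inj_on, rule strict_mono_onI)
    fix r s assume rs: "r \<in> N \<inter> {..<e}" "s \<in> N \<inter> {..<e}" "r < s"
    then show "card (N \<inter> {..<r}) < card (N \<inter> {..<s})"
      using fin_below by (intro psubset_card_mono) auto
  qed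
  then have "countable (N \<inter> {..<e})" by (rule countableI')
  moreover have "finite (N - {..e})"
  proof -
    have "finite ((Y - {..e}) \<inter> C)"
    proof (rule finite_no_limpt[OF comp])
      show "closed (Y - {..e})" using Y open_atMost_wellorder[of e] by auto
      show "\<not> x islimpt C" if "x \<in> Y - {..e}" for x
        using lim[of x] that by auto
    qed
    then show ?thesis by (rule finite_subset[rotated]) (auto simp: N_def)
  qed
  moreover have "N = (N \<inter> {..<e}) \<union> (N - {..e})" by (auto simp: N_def)
  ultimately have "countable N" by (metis countable_Un countable_finite)
  moreover have "infinite N" using inf by (meson finite_Int)
  ultimately have g: "bij_betw (from_nat_into N) UNIV N" by (rule bij_betw_from_nat_into)
  define P where "P x = {d \<in> Y - {e}. ceil_in N x0 d = x}" for x
  have P_open: "open (P x)" for x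
  proof (subst open_subopen, safe)
    fix d assume d: "d \<in> P x"
    then have "\<not> d islimpt C" using lim by (auto simp: P_def)
    then have "\<not> d islimpt N" using islimpt_subset[of d N C] by (auto simp: N_def)
    then obtain U where U: "open U" "d \<in> U" "\<forall>y\<in>U. ceil_in N x0 y = ceil_in N x0 d"
      using ceil_in_locally_constant by metis
    moreover have "ceil_in N x0 d = x" "d \<in> Y - {e}" using d by (auto simp: P_def)
    ultimately have "U \<inter> (Y - {e}) \<subseteq> P x" "d \<in> U \<inter> (Y - {e})" unfolding P_def by blast+
    moreover have "open (U \<inter> (Y - {e}))" using U Y by (intro open_Int open_delete) auto
    ultimately show "\<exists>T. open T \<and> d \<in> T \<and> T \<subseteq> P x" by blast
  qed
  have PC: "P x \<inter> C = {x}" if "x \<in> N" for x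
    using that ceil_in_self[of _ N x0] by (auto simp: P_def N_def)
  have P_un: "(\<Union>x\<in>N. P x) = Y - {e}"
    using ceil_in_mem[OF x0(1)] by (auto simp: P_def)
  have P_closed: "closed (P x)" if x: "x \<in> N" for x
  proof -
    \<comment> \<open>Serves to build a neighbourhood W of e that misses \<open>P x\<close>. If x
      lies above e, any bound below e works, since points just below e are rounded to values below
      e; x0 was chosen below e for this.\<close>
    define m where "m = (if x < e then x else x0)"
    define W where "W = Y \<inter> {m<..} \<inter> {..e}"
    have "open W" unfolding W_def using Y open_atMost_wellorder by (intro open_Int) auto
    moreover have "e \<in> W" using Y x0 by (auto simp: W_def m_def)
    ultimately have W: "open W" "e \<in> W" .
    have Wx: "d \<notin> P x" if "d \<in> W" for d
    proof
      assume dP: "d \<in> P x"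
      then have "d < e" "m < d" using that by (auto simp: W_def P_def)
      then obtain y where y: "y \<in> N" "d < y" "y < e" using cofinal by blast
      have "d \<le> x" "x \<le> y" using ceil_in_ge[OF y(1), of d x0] y(2) dP by (auto simp: P_def)
      then show False using \<open>m < d\<close> y(3) by (auto simp: m_def split: if_splits)
    qed
    have "- P x = (- Y) \<union> W \<union> (\<Union>y\<in>N - {x}. P y)"
    proof
      show "- P x \<subseteq> (- Y) \<union> W \<union> (\<Union>y\<in>N - {x}. P y)"
      proof
        fix d assume d: "d \<in> - P x"
        then consider "d \<notin> Y" | "d = e" | "d \<in> Y - {e}" by blast
        then show "d \<in> (- Y) \<union> W \<union> (\<Union>y\<in>N - {x}. P y)"
        proof cases
          case 3
          then obtain y where "y \<in> N" "d \<in> P y" using P_un by blast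
          then show ?thesis using d by auto
        qed (use W in auto)
      qed
      show "(- Y) \<union> W \<union> (\<Union>y\<in>N - {x}. P y) \<subseteq> - P x"
        using Wx by (auto simp: P_def)
    qed
    moreover have "open ((- Y) \<union> W \<union> (\<Union>y\<in>N - {x}. P y))"
      using Y W P_open by (intro open_Un open_UN) auto
    ultimately show ?thesis by (simp add: closed_def)
  qed
  define K where "K k = P (from_nat_into N k)" for k
  have gN: "from_nat_into N k \<in> N" for k using g by (auto simp: bij_betw_def)
  have "disjoint_family K"
    unfolding disjoint_family_on_def
  proof (intro ballI impI)
    fix m n :: nat assume "m \<noteq> n"
    then have "from_nat_into N m \<noteq> from_nat_into N n"
      using g unfolding bij_betw_def inj_on_def by auto
    then show "K m \<inter> K n = {}" by (auto simp: K_def P_def)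
  qed
  moreover have "(\<Union>k. K k) = Y - {e}"
    using P_un g unfolding K_def bij_betw_def by (metis image_image)
  ultimately show ?thesis
    using P_open P_closed PC gN by (intro exI[of _ K]) (auto simp: K_def)
qed

text \<open>Again the fibres of rounding up, now to E: a finite set has no limit points, so rounding
  is locally constant everywhere. Points above \<open>Max E\<close> join its class.\<close>

lemma ex_clopen_partition:
  fixes E :: "'a::{wellorder, linorder_topology} set"
  assumes "finite E" "E \<noteq> {}"
  shows "\<exists>Y. (\<forall>e\<in>E. open (Y e) \<and> closed (Y e) \<and> e \<in> Y e) \<and>
    disjoint_family_on Y E \<and> (\<Union>e\<in>E. Y e) = UNIV"
proof -
  define r where "r = ceil_in E (Max E)"
  define Y where "Y e = {x. r x = e}" for e
  have rE: "r x \<in> E" for x using assms by (simp add: r_def ceil_in_mem)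
  have op: "open (Y e)" for e
  proof (subst open_subopen, safe)
    fix x assume x: "x \<in> Y e"
    have "\<not> x islimpt E" using assms by (simp add: islimpt_finite)
    then obtain U where U: "open U" "x \<in> U" "\<forall>y\<in>U. r y = r x"
      using ceil_in_locally_constant unfolding r_def by metis
    moreover have "r x = e" using x by (simp add: Y_def)
    ultimately have "U \<subseteq> Y e" unfolding Y_def by blast
    then show "\<exists>T. open T \<and> x \<in> T \<and> T \<subseteq> Y e" using U by blast
  qed
  have cl: "closed (Y e)" for e
  proof -
    have "- Y e = (\<Union>e'\<in>E - {e}. Y e')" using rE by (auto simp: Y_def)
    then show ?thesis using op by (simp add: closed_def open_UN)
  qed
  show ?thesis
    using op cl rE by (intro exI[of _ Y]) (auto simp: Y_def disjoint_family_on_def r_def ceil_in_self)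
qed

section \<open>Length functions and supports\<close>

abbreviation hinv :: "('a \<Rightarrow> 'a) \<Rightarrow> 'a \<Rightarrow> 'a" where
  "hinv \<equiv> inv_into UNIV"

lemma Homeo_bij: "h \<in> carrier Homeo \<Longrightarrow> bij h"
  by (simp add: carrier_Homeo_iff open_homeo_def)

lemma Homeo_id: "id \<in> carrier Homeo"
  by (simp add: carrier_Homeo_iff open_homeo_id)

lemma Homeo_comp: "g \<in> carrier Homeo \<Longrightarrow> h \<in> carrier Homeo \<Longrightarrow> g \<circ> h \<in> carrier Homeo"
  unfolding carrier_Homeo_iff by (rule open_homeo_comp)

lemma Homeo_inv: "h \<in> carrier Homeo \<Longrightarrow> hinv h \<in> carrier Homeo"
  unfolding carrier_Homeo_iff by (rule open_homeo_inv)

lemma Homeo_funpow: "h \<in> carrier Homeo \<Longrightarrow> h ^^ n \<in> carrier Homeo"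
  by (induction n) (auto simp: Homeo_id Homeo_comp)

lemma Homeo_inv_simps:
  assumes "h \<in> carrier Homeo"
  shows "h (hinv h x) = x" "hinv h (h x) = x" "h \<circ> hinv h = id" "hinv h \<circ> h = id"
  using Homeo_bij[OF assms] by (auto simp: bij_def surj_f_inv_f)

lemma Homeo_open_image: "h \<in> carrier Homeo \<Longrightarrow> open U \<Longrightarrow> open (h ` U)"
  by (simp add: carrier_Homeo_iff open_homeo_def)

lemma Homeo_closed_image:
  assumes "h \<in> carrier Homeo" "closed U"
  shows "closed (h ` U)"
  using assms Homeo_open_image[of h "- U"] Homeo_bij[of h]
  by (simp add: closed_def bij_image_Compl_eq)

lemma Homeo_open_vimage:
  assumes "h \<in> carrier Homeo" "open U"
  shows "open (h -` U)"
  using assms Homeo_open_image[OF Homeo_inv[OF assms(1)]] Homeo_bij[of h]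
  by (simp add: bij_vimage_eq_inv_image)

lemma Homeo_open_homeo: "h \<in> carrier Homeo \<Longrightarrow> open U \<Longrightarrow> open_homeo U (h ` U) h"
  using open_homeo_subset[of UNIV UNIV h U] by (simp add: carrier_Homeo_iff)

text \<open>S need not contain the closure of the moved points: for infinite I, an element of
  \<open>supported (pieces e I)\<close> may move points arbitrarily close to e.\<close>

definition supported :: "'a::topological_space set \<Rightarrow> ('a \<Rightarrow> 'a) set" where
  "supported S = {h \<in> carrier Homeo. \<forall>x. x \<notin> S \<longrightarrow> h x = x}"

lemma supportedD:
  assumes "h \<in> supported S"
  shows "h \<in> carrier Homeo" "\<And>x. x \<notin> S \<Longrightarrow> h x = x" "h ` S = S" "\<And>x. x \<in> S \<Longrightarrow> h x \<in> S"
proof -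
  show 1: "h \<in> carrier Homeo" and 2: "\<And>x. x \<notin> S \<Longrightarrow> h x = x"
    using assms by (auto simp: supported_def)
  have bij: "bij h" using Homeo_bij[OF 1] .
  show 3: "h x \<in> S" if "x \<in> S" for x
    using 2[of "h x"] that bij by (metis bij_def injD)
  show "h ` S = S"
  proof
    show "h ` S \<subseteq> S" using 3 by blast
    show "S \<subseteq> h ` S"
    proof
      fix y assume "y \<in> S"
      moreover obtain x where "y = h x" using bij by (metis bij_pointE)
      ultimately show "y \<in> h ` S" using 2[of x] by (cases "x \<in> S") auto
    qed
  qed
qed

lemma supported_open_homeo: "h \<in> supported S \<Longrightarrow> open S \<Longrightarrow> open_homeo S S h"
  using Homeo_open_homeo[of h S] supportedD(1,3)[of h S] by simp

text \<open>The properties of \<open>d id\<close> for a left-invariant metric d on which the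
  estimates rest; no continuity is involved.\<close>

definition length_fun :: "(('a::topological_space \<Rightarrow> 'a) \<Rightarrow> real) \<Rightarrow> bool" where
  "length_fun l \<longleftrightarrow> l id = 0 \<and>
     (\<forall>g\<in>carrier Homeo. \<forall>h\<in>carrier Homeo. l (g \<circ> h) \<le> l g + l h) \<and>
     (\<forall>g\<in>carrier Homeo. l (hinv g) = l g)"

lemma length_fun_comp:
  "length_fun l \<Longrightarrow> g \<in> carrier Homeo \<Longrightarrow> h \<in> carrier Homeo \<Longrightarrow> l (g \<circ> h) \<le> l g + l h"
  by (simp add: length_fun_def)

lemma length_fun_inv: "length_fun l \<Longrightarrow> g \<in> carrier Homeo \<Longrightarrow> l (hinv g) = l g"
  by (simp add: length_fun_def)

lemma length_fun_funpow:
  assumes "length_fun l" "g \<in> carrier Homeo"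
  shows "l (g ^^ n) \<le> real n * l g"
proof (induction n)
  case 0
  then show ?case using assms by (simp add: length_fun_def id_def)
next
  case (Suc n)
  then show ?case
    using length_fun_comp[OF assms(1,2) Homeo_funpow[OF assms(2), of n]] by (simp add: algebra_simps o_def)
qed

section \<open>Decomposition into pieces\<close>

text \<open>From here on the order on the space is forgotten: well-orders enter only through
  \<open>clopen_homeo\<close> and the existence of the pieces. That the pieces of \<open>Y e\<close>
  converge to e is not assumed; compactness yields it.\<close>

locale piece_decomposition =
  fixes C E :: "'a::t2_space set" and Y :: "'a \<Rightarrow> 'a set" and K :: "'a \<Rightarrow> nat \<Rightarrow> 'a set"
  assumes compact_UNIV: "compact (UNIV :: 'a set)"
    and Homeo_C: "\<And>h x. h \<in> carrier Homeo \<Longrightarrow> h x \<in> C \<longleftrightarrow> x \<in> C"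
    and Homeo_E: "\<And>h x. h \<in> carrier Homeo \<Longrightarrow> h x \<in> E \<longleftrightarrow> x \<in> E"
    and finite_E: "finite E" and E_nonempty: "E \<noteq> {}"
    and finite_C: "\<And>Z. closed Z \<Longrightarrow> Z \<inter> E = {} \<Longrightarrow> finite (Z \<inter> C)"
    and clopen_homeo: "\<And>Z Z'. \<lbrakk>open Z; closed Z; open Z'; closed Z'; finite (Z \<inter> C); Z \<inter> C \<noteq> {};
           card (Z' \<inter> C) = card (Z \<inter> C)\<rbrakk> \<Longrightarrow> \<exists>h. open_homeo Z Z' h"
    and Y_clopen: "\<And>e. e \<in> E \<Longrightarrow> open (Y e)" "\<And>e. e \<in> E \<Longrightarrow> closed (Y e)"
    and Y_mem: "\<And>e. e \<in> E \<Longrightarrow> e \<in> Y e"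
    and Y_disjoint: "disjoint_family_on Y E"
    and Y_cover: "(\<Union>e\<in>E. Y e) = UNIV"
    and K_clopen: "\<And>e k. e \<in> E \<Longrightarrow> open (K e k)" "\<And>e k. e \<in> E \<Longrightarrow> closed (K e k)"
    and K_single: "\<And>e k. e \<in> E \<Longrightarrow> \<exists>x. K e k \<inter> C = {x}"
    and K_disjoint: "\<And>e. e \<in> E \<Longrightarrow> disjoint_family (K e)"
    and K_cover: "\<And>e. e \<in> E \<Longrightarrow> (\<Union>k. K e k) = Y e - {e}"
begin

definition pieces :: "'a \<Rightarrow> nat set \<Rightarrow> 'a set" where
  "pieces e I = (\<Union>k\<in>I. K e k)"

definition pt :: "'a \<Rightarrow> nat \<Rightarrow> 'a" where
  "pt e k = (THE x. K e k \<inter> C = {x})"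

lemma pt: "e \<in> E \<Longrightarrow> K e k \<inter> C = {pt e k}"
  unfolding pt_def by (rule theI') (use K_single[of e k] in auto)

lemma pt_mem: "e \<in> E \<Longrightarrow> pt e k \<in> K e k" "e \<in> E \<Longrightarrow> pt e k \<in> C"
  using pt by blast+

lemma K_eq: "e \<in> E \<Longrightarrow> x \<in> K e k \<Longrightarrow> x \<in> K e j \<Longrightarrow> k = j"
  using K_disjoint unfolding disjoint_family_on_def by blast

lemma inj_pt: "e \<in> E \<Longrightarrow> inj (pt e)"
  by (rule injI) (metis K_eq pt_mem(1))

lemma K_homeo: "e \<in> E \<Longrightarrow> e' \<in> E \<Longrightarrow> \<exists>h. open_homeo (K e k) (K e' k') h"
  using clopen_homeo[of "K e k" "K e' k'"] K_clopen pt by simp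

lemma open_pieces: "e \<in> E \<Longrightarrow> open (pieces e I)"
  unfolding pieces_def using K_clopen by auto

lemma pieces_UNIV: "e \<in> E \<Longrightarrow> pieces e UNIV = Y e - {e}"
  by (simp add: pieces_def K_cover)

lemma pieces_Un: "pieces e (I \<union> J) = pieces e I \<union> pieces e J"
  by (auto simp: pieces_def)

lemma pieces_Diff: "e \<in> E \<Longrightarrow> pieces e (I - J) = pieces e I - pieces e J"
  unfolding pieces_def by (auto dest: K_eq)

lemma pieces_Compl: "e \<in> E \<Longrightarrow> pieces e (- J) = Y e - {e} - pieces e J"
  by (metis Compl_eq_Diff_UNIV pieces_Diff pieces_UNIV)

lemma pieces_subset: "e \<in> E \<Longrightarrow> pieces e I \<subseteq> Y e - {e}"
  using pieces_UNIV unfolding pieces_def by blast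

lemma closed_pieces: "e \<in> E \<Longrightarrow> finite I \<Longrightarrow> closed (pieces e I)"
  unfolding pieces_def using K_clopen by auto

lemma pieces_C: "e \<in> E \<Longrightarrow> pieces e I \<inter> C = pt e ` I"
  using pt unfolding pieces_def by auto

lemma infinite_pieces_C: "e \<in> E \<Longrightarrow> infinite I \<Longrightarrow> infinite (pieces e I \<inter> C)"
  using inj_pt[of e] by (simp add: pieces_C finite_image_iff inj_on_subset)

lemma E_Int_Y: "e \<in> E \<Longrightarrow> x \<in> E \<Longrightarrow> x \<in> Y e \<Longrightarrow> x = e"
  using Y_disjoint Y_mem unfolding disjoint_family_on_def by blast

lemma supported_Y_fixes: "e \<in> E \<Longrightarrow> h \<in> supported (Y e) \<Longrightarrow> h e = e"
  using E_Int_Y[of e "h e"] Homeo_E[of h e] supportedD(1,4)[of h "Y e"] Y_mem by simp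

text \<open>The compact set \<open>Y e - U\<close> is covered by finitely many of the pieces, and by
  disjointness all others lie in U.\<close>

lemma eventually_K_subset:
  assumes e: "e \<in> E" and U: "open U" "e \<in> U"
  shows "\<exists>k. \<forall>j\<ge>k. K e j \<subseteq> U"
proof -
  have "compact (Y e - U)"
    using compact_Int_closed[OF compact_UNIV, of "Y e - U"] Y_clopen[OF e] U by auto
  moreover have "Y e - U \<subseteq> (\<Union>k\<in>UNIV. K e k)" using K_cover[OF e] U by blast
  ultimately obtain J where J: "finite J" "Y e - U \<subseteq> (\<Union>k\<in>J. K e k)"
    using K_clopen[OF e] by (metis compactE_image)
  obtain k where k: "\<forall>j\<in>J. j < k" using J(1) finite_nat_set_iff_bounded by blast
  have "K e j \<subseteq> U" if "j \<ge> k" for j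
  proof
    fix x assume x: "x \<in> K e j"
    then have "x \<in> Y e" using K_cover[OF e] by blast
    show "x \<in> U"
    proof (rule ccontr)
      assume "x \<notin> U"
      then obtain i where "i \<in> J" "x \<in> K e i" using J(2) \<open>x \<in> Y e\<close> by blast
      then show False using K_eq[OF e x] k that by auto
    qed
  qed
  then show ?thesis by blast
qed

lemma extend_supported_Y:
  assumes e: "e \<in> E" and h: "open_homeo (Y e) (Y e) h"
  shows "(\<lambda>x. if x \<in> Y e then h x else x) \<in> supported (Y e)"
proof -
  have "open_homeo (Y e \<union> - Y e) (Y e \<union> - Y e) (\<lambda>x. if x \<in> Y e then h x else id x)"
    by (rule ex_open_homeo_Un[OF h open_homeo_id]) (use Y_clopen[OF e] in auto)
  then show ?thesis unfolding id_apply by (simp add: supported_def carrier_Homeo_iff)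
qed

text \<open>S is clopen in \<open>Y e - {e}\<close> but may accumulate at e. Gluing with the
  identity therefore settles everything except e, where \<open>open_homeo_insert_point\<close> takes
  over.\<close>

lemma extend_supported:
  assumes e: "e \<in> E" and S: "S \<subseteq> Y e - {e}" "open (Y e - {e} - S)" and h: "open_homeo S S h"
  shows "(\<lambda>x. if x \<in> S then h x else x) \<in> supported S" (is "?h \<in> _")
proof -
  have "open_homeo (S \<union> (Y e - {e} - S)) (S \<union> (Y e - {e} - S)) (\<lambda>x. if x \<in> S then h x else id x)"
    by (rule ex_open_homeo_Un[OF h open_homeo_id[OF S(2)]]) auto
  moreover have "S \<union> (Y e - {e} - S) = Y e - {e}" using S by auto
  ultimately have "open_homeo (Y e - {e}) (Y e - {e}) ?h" unfolding id_apply by metis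
  moreover have "insert e (Y e - {e}) = Y e" using Y_mem[OF e] by auto
  moreover have "?h e = e" using S(1) by auto
  ultimately have "open_homeo (Y e) (Y e) ?h"
    using open_homeo_insert_point[OF compact_UNIV, of "Y e - {e}" "Y e - {e}" ?h e] Y_clopen[OF e]
    by simp
  then have "(\<lambda>x. if x \<in> Y e then ?h x else x) \<in> supported (Y e)"
    by (rule extend_supported_Y[OF e])
  moreover have "(\<lambda>x. if x \<in> Y e then ?h x else x) = ?h"
    using S(1) by (auto simp: fun_eq_iff)
  ultimately show ?thesis by (simp add: supported_def)
qed

text \<open>Relatively clopen in \<open>Y e - {e}\<close>, with infinitely many points of C. These
  sets are all homeomorphic to each other, so any two can be exchanged freely.\<close>

definition big :: "'a \<Rightarrow> 'a set \<Rightarrow> bool" where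
  "big e S \<longleftrightarrow> S \<subseteq> Y e - {e} \<and> open S \<and> open (Y e - {e} - S) \<and> infinite (S \<inter> C)"

lemma big_pieces: "e \<in> E \<Longrightarrow> infinite I \<Longrightarrow> big e (pieces e I)"
  unfolding big_def
  using pieces_subset open_pieces infinite_pieces_C pieces_Compl[of e I] open_pieces[of e "- I"] by simp

text \<open>Traces of S on pieces may miss C. Rounding indices up to J merges each such trace with
  the next one that meets C. Only finitely many are merged at a time, so each \<open>G j\<close> is
  clopen with exactly one point of C, hence homeomorphic to any piece; the two sequences are then
  matched term by term.\<close>

lemma big_homeo_all:
  assumes e: "e \<in> E" and S: "big e S"
  shows "\<exists>h. open_homeo S (Y e - {e}) h"
proof -
  have S': "S \<subseteq> Y e - {e}" "open S" "open (Y e - {e} - S)" "infinite (S \<inter> C)"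
    using S by (auto simp: big_def)
  define J where "J = {k. S \<inter> K e k \<inter> C \<noteq> {}}"
  have "S \<inter> C = (\<Union>k\<in>J. S \<inter> K e k \<inter> C)"
  proof (intro equalityI subsetI)
    fix x assume x: "x \<in> S \<inter> C"
    then obtain k where "x \<in> K e k" using S'(1) K_cover[OF e] by blast
    then show "x \<in> (\<Union>k\<in>J. S \<inter> K e k \<inter> C)" using x unfolding J_def by blast
  qed blast
  moreover have "finite (S \<inter> K e k \<inter> C)" for k
    by (rule finite_subset[of _ "{pt e k}"]) (use pt[OF e, of k] in auto)
  ultimately have inf: "infinite J" using S'(4) by (metis finite_UN_I)
  then obtain j0 where j0: "j0 \<in> J" by (metis finite.emptyI ex_in_conv)
  define G where "G j = (\<Union>i\<in>{i. ceil_in J j0 i = j}. S \<inter> K e i)" for j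
  have ex: "\<exists>j\<in>J. i \<le> j" for i using inf by (meson infinite_nat_iff_unbounded_le)
  have ge: "i \<le> ceil_in J j0 i" for i using ex[of i] ceil_in_ge(2) by blast
  have fin: "finite {i. ceil_in J j0 i = j}" for j
    by (rule finite_subset[of _ "{..j}"]) (use ge in auto)
  have "open (G j)" for j unfolding G_def using S' K_clopen[OF e] by auto
  moreover have "closed (G j)" for j
  proof -
    have "S \<inter> K e i = K e i - (Y e - {e} - S)" for i using K_cover[OF e] by blast
    then have "closed (S \<inter> K e i)" for i using K_clopen[OF e] S'(3) by (simp add: closed_Diff)
    then show ?thesis unfolding G_def using fin by (intro closed_UN) auto
  qed
  moreover have "\<exists>x. G j \<inter> C = {x}" if j: "j \<in> J" for j
  proof -
    have empty: "S \<inter> K e i \<inter> C = {}" if "ceil_in J j0 i = j" "i \<noteq> j" for i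
    proof -
      have "i \<notin> J" using ceil_in_self[of i J j0] that by auto
      then show ?thesis by (simp add: J_def)
    qed
    have "G j \<inter> C = S \<inter> K e j \<inter> C"
    proof (intro equalityI subsetI)
      fix x assume "x \<in> G j \<inter> C"
      then obtain i where "ceil_in J j0 i = j" "x \<in> S \<inter> K e i \<inter> C" by (auto simp: G_def)
      then show "x \<in> S \<inter> K e j \<inter> C" using empty[of i] by (cases "i = j") auto
    next
      fix x assume "x \<in> S \<inter> K e j \<inter> C"
      then show "x \<in> G j \<inter> C" using ceil_in_self[OF j, of j0] by (auto simp: G_def)
    qed
    moreover have "S \<inter> K e j \<inter> C = {pt e j}"
    proof -
      have "S \<inter> K e j \<inter> C \<subseteq> {pt e j}" using pt[OF e, of j] by auto
      moreover have "S \<inter> K e j \<inter> C \<noteq> {}" using j by (simp add: J_def)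
      ultimately show ?thesis by blast
    qed
    ultimately show ?thesis by simp
  qed
  moreover have bij: "bij_betw (from_nat_into J) UNIV J"
    using inf by (intro bij_betw_from_nat_into) auto
  ultimately have G: "open (G (from_nat_into J k))" "closed (G (from_nat_into J k))"
      "\<exists>x. G (from_nat_into J k) \<inter> C = {x}" for k
    using bij_betwE[OF bij] by blast+
  have "\<exists>h. open_homeo (G (from_nat_into J k)) (K e k) h" for k
    using G[of k] pt[OF e, of k] K_clopen[OF e, of k] by (intro clopen_homeo) auto
  then obtain h where h: "\<And>k. open_homeo (G (from_nat_into J k)) (K e k) (h k)" by metis
  have dis: "disjoint_family (\<lambda>k. G (from_nat_into J k))"
    unfolding disjoint_family_on_def
  proof (intro ballI impI)
    fix m n :: nat assume "m \<noteq> n"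
    then have ne: "from_nat_into J m \<noteq> from_nat_into J n"
      using bij unfolding bij_betw_def inj_on_def by auto
    show "G (from_nat_into J m) \<inter> G (from_nat_into J n) = {}"
    proof (rule ccontr)
      assume "G (from_nat_into J m) \<inter> G (from_nat_into J n) \<noteq> {}"
      then obtain x i i' where "x \<in> K e i" "x \<in> K e i'" "ceil_in J j0 i = from_nat_into J m"
          "ceil_in J j0 i' = from_nat_into J n"
        by (auto simp: G_def)
      then show False using K_eq[OF e] ne by metis
    qed
  qed
  have "(\<Union>k. G (from_nat_into J k)) = (\<Union>j\<in>J. G j)"
    using bij unfolding bij_betw_def by (metis image_image)
  also have "\<dots> = S"
  proof
    show "(\<Union>j\<in>J. G j) \<subseteq> S" by (auto simp: G_def)
    show "S \<subseteq> (\<Union>j\<in>J. G j)"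
    proof
      fix x assume x: "x \<in> S"
      then obtain i where "x \<in> K e i" using S'(1) K_cover[OF e] by blast
      then show "x \<in> (\<Union>j\<in>J. G j)"
        using x ceil_in_mem[OF j0, of i] by (auto simp: G_def)
    qed
  qed
  finally have "(\<Union>k. G (from_nat_into J k)) = S" .
  then show ?thesis
    using ex_open_homeo_glue[OF h dis K_disjoint[OF e]] K_cover[OF e] by metis
qed

lemma big_homeo:
  assumes "e \<in> E" "big e S" "big e T"
  shows "\<exists>h. open_homeo S T h"
  using big_homeo_all[OF assms(1,2)] big_homeo_all[OF assms(1,3)] open_homeo_comp open_homeo_inv
  by blast

end

section \<open>Bounded lengths inside one set \<open>Y e\<close>\<close>

text \<open>Labels the pieces for the swindle: I is the copy at the origin, and its complement is
  distributed over the other labels so that each occurs infinitely often.\<close>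

lemma ex_two_parameter_index:
  fixes I :: "nat set"
  assumes "infinite I" "infinite (- I)"
  shows "\<exists>q :: nat \<Rightarrow> int \<times> int. q -` {(0, 0)} = I \<and> (\<forall>p. infinite (q -` {p}))"
proof -
  \<comment> \<open>The first component of the pair code gives the label and the free second one
    makes it recur infinitely often. The origin is reserved for I, so (1, 0) replaces it.\<close>
  define c :: "nat \<Rightarrow> int \<times> int" where
    "c n = (let p = from_nat (fst (prod_decode n)) in if p = (0, 0) then (1, 0) else p)" for n
  have c0: "c n \<noteq> (0, 0)" for n by (simp add: c_def Let_def)
  have c_inf: "infinite (c -` {p})" if "p \<noteq> (0, 0)" for p
  proof -
    have "(\<lambda>m. prod_encode (to_nat p, m)) ` UNIV \<subseteq> c -` {p}"
      using that by (auto simp: c_def)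
    moreover have "infinite ((\<lambda>m. prod_encode (to_nat p, m)) ` UNIV)"
      by (subst finite_image_iff) (auto simp: inj_on_def)
    ultimately show ?thesis using finite_subset by blast
  qed
  define q where "q k = (if k \<in> I then (0, 0) else c (to_nat_on (- I) k))" for k
  have bij: "bij_betw (to_nat_on (- I)) (- I) UNIV"
    using assms(2) by (intro to_nat_on_infinite) auto
  have I: "q -` {(0, 0)} = I" using c0 by (auto simp: q_def split: if_splits)
  have "infinite (q -` {p})" for p
  proof (cases "p = (0, 0)")
    case True
    then show ?thesis using I assms(1) by simp
  next
    case False
    have "c -` {p} \<subseteq> to_nat_on (- I) ` (q -` {p})"
    proof
      fix n assume n: "n \<in> c -` {p}"
      obtain k where k: "k \<in> - I" "n = to_nat_on (- I) k"
        using bij unfolding bij_betw_def by blast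
      then have "k \<in> q -` {p}" using n by (auto simp: q_def)
      then show "n \<in> to_nat_on (- I) ` (q -` {p})" using k by blast
    qed
    then show ?thesis using c_inf[OF False] finite_surj by blast
  qed
  then show ?thesis using I by blast
qed

lemma square_not_linearly_bounded:
  fixes a c :: real
  assumes "\<And>k::nat. real k * real k \<le> real k * a + c"
  shows False
proof -
  obtain k :: nat where k: "real k > \<bar>a\<bar> + \<bar>c\<bar> + 1" using reals_Archimedean2 by blast
  then have k1: "real k \<ge> 1" by linarith
  have "real k * a + c \<le> real k * \<bar>a\<bar> + real k * \<bar>c\<bar>"
  proof (rule add_mono)
    show "real k * a \<le> real k * \<bar>a\<bar>" by (intro mult_left_mono) auto
    have "1 * \<bar>c\<bar> \<le> real k * \<bar>c\<bar>" using k1 by (intro mult_right_mono) auto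
    then show "c \<le> real k * \<bar>c\<bar>" by linarith
  qed
  also have "\<dots> = real k * (\<bar>a\<bar> + \<bar>c\<bar>)" by (simp add: algebra_simps)
  also have "\<dots> < real k * real k" using k k1 by (intro mult_strict_left_mono) auto
  finally show False using assms[of k] by simp
qed

context piece_decomposition
begin

text \<open>Every sequence \<open>f k\<close> in \<open>supported V\<close> is uniformly distorted: with copies of \<open>V\<close> indexed by
  \<open>\<int> \<times> \<int>\<close>, let \<open>F\<close> act as \<open>f i\<close> on the copies \<open>(i, j)\<close> with \<open>i, j \<ge> 0\<close>, let \<open>s\<close> shift the first
  coordinate and \<open>t\<close> the second coordinate of the copies \<open>(0, j)\<close> only. Then \<open>f k\<close> is the
  commutator of \<open>s\<^sup>-\<^sup>k F s\<^sup>k\<close> and \<open>t\<close>, a word of length linear in \<open>k\<close> in three letters.\<close>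
lemma bdd_above_length_supported_pieces:
  assumes e: "e \<in> E" and I: "infinite I" "infinite (- I)" and l: "length_fun l"
  shows "bdd_above (l ` supported (pieces e I))"
proof (rule ccontr)
  assume unb: "\<not> bdd_above (l ` supported (pieces e I))"
  define V where "V = pieces e I"
  \<comment> \<open>Any growth faster than linear in k would contradict the word length found
    below.\<close>
  have "\<exists>f\<in>supported V. real k * real k < l f" for k :: nat
    using unb unfolding V_def bdd_above_def by (auto simp: not_le)
  then obtain f where f: "\<And>k::nat. f k \<in> supported V" "\<And>k. real k * real k < l (f k)" by metis
  obtain q :: "nat \<Rightarrow> int \<times> int" where q: "q -` {(0, 0)} = I" "\<And>p. infinite (q -` {p})"
    using ex_two_parameter_index[OF I] by blast
  define W where "W p = pieces e (q -` {p})" for p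
  have W0: "W (0, 0) = V" by (simp add: W_def V_def q)
  have V: "open V" using open_pieces[OF e] by (simp add: V_def)
  have W_dis: "disjoint_family W"
    unfolding disjoint_family_on_def
  proof (intro ballI impI)
    fix p p' :: "int \<times> int" assume "p \<noteq> p'"
    then have "q -` {p} = q -` {p} - q -` {p'}" by auto
    then show "W p \<inter> W p' = {}"
      unfolding W_def using pieces_Diff[OF e] by (metis Diff_disjoint inf_commute)
  qed
  have W_un: "(\<Union>p. W p) = Y e - {e}"
    using K_cover[OF e] by (auto simp: W_def pieces_def)
  have "\<exists>h. open_homeo V (W p) h" for p
    using big_homeo[OF e] big_pieces[OF e] I q(2) unfolding V_def W_def by blast
  then obtain th0 where th0: "\<And>p. open_homeo V (W p) (th0 p)" by metis
  \<comment> \<open>Choosing the identity at the origin makes that copy V itself, so the commutator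
    is literally \<open>f k\<close> and not a conjugate of it.\<close>
  define th where "th p = (if p = (0, 0) then id else th0 p)" for p
  have th: "open_homeo V (W p) (th p)" for p
    using th0 W0 open_homeo_id[OF V] by (auto simp: th_def)
  have th_0: "th (0, 0) = id" by (simp add: th_def)
  have th_W: "th p x \<in> W p" if "x \<in> V" for p x using open_homeoD(7)[OF th that] .
  have cover: "\<exists>p x. x \<in> V \<and> y = th p x" if y: "y \<in> Y e - {e}" for y
  proof -
    obtain p where "y \<in> W p" using y W_un by blast
    then have "y \<in> th p ` V" using open_homeoD(5)[OF th[of p]] by simp
    then show ?thesis by blast
  qed
  \<comment> \<open>The copies carry a full wreath product: a permutation r of the labels and a
    homeomorphism of V for each label can be prescribed at once. All three letters are
    instances.\<close>
  have wreath: "\<exists>F. F \<in> supported (Y e - {e}) \<and> (\<forall>p. \<forall>x\<in>V. F (th p x) = th (r p) (phi p x))"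
    if r: "bij r" and phi: "\<And>p. open_homeo V V (phi p)" for r phi
  proof -
    have hom: "open_homeo (W p) (W (r p)) (th (r p) \<circ> phi p \<circ> inv_into V (th p))" for p
      using open_homeo_comp[OF open_homeo_comp[OF open_homeo_inv[OF th[of p]] phi[of p]] th[of "r p"]]
      by (simp add: comp_assoc)
    have dis: "disjoint_family (\<lambda>p. W (r p))"
      using W_dis r unfolding disjoint_family_on_def bij_def inj_def by blast
    obtain F where F: "open_homeo (\<Union>p. W p) (\<Union>p. W (r p)) F"
      "\<And>p x. x \<in> W p \<Longrightarrow> F x = (th (r p) \<circ> phi p \<circ> inv_into V (th p)) x"
      using ex_open_homeo_glue[OF hom W_dis dis] by (metis UNIV_I)
    have "(\<Union>p. W (r p)) = (\<Union>p. W p)" using r by (metis bij_is_surj image_image)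
    then have "open_homeo (Y e - {e}) (Y e - {e}) F" using F(1) W_un by simp
    then have "(\<lambda>x. if x \<in> Y e - {e} then F x else x) \<in> supported (Y e - {e})"
      by (intro extend_supported[OF e]) auto
    moreover have "(\<lambda>x. if x \<in> Y e - {e} then F x else x) (th p x) = th (r p) (phi p x)"
      if x: "x \<in> V" for p x
    proof -
      have "inv_into V (th p) (th p x) = x" using open_homeoD(4)[OF th] x by simp
      moreover have "th p x \<in> Y e - {e}" using th_W[OF x] W_un by blast
      ultimately show ?thesis using F(2)[OF th_W[OF x]] by simp
    qed
    ultimately show ?thesis by blast
  qed
  have fV: "open_homeo V V (f k)" for k using supported_open_homeo[OF f(1) V] .
  define phi where "phi = (\<lambda>(i::int, j::int). if i \<ge> 0 \<and> j \<ge> 0 then f (nat i) else id)"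
  have phi: "open_homeo V V (phi p)" for p
    using fV open_homeo_id[OF V] by (auto simp: phi_def split: prod.split)
  have bs: "bij (\<lambda>(i::int, j::int). (i + 1, j))"
    by (rule bij_betw_byWitness[where f' = "\<lambda>(i, j). (i - 1, j)"]) auto
  have bt: "bij (\<lambda>(i::int, j::int). (i, if i = 0 then j + 1 else j))"
    by (rule bij_betw_byWitness[where f' = "\<lambda>(i, j). (i, if i = 0 then j - 1 else j)"]) auto
  obtain F where F: "F \<in> supported (Y e - {e})" "\<And>p x. x \<in> V \<Longrightarrow> F (th p x) = th p (phi p x)"
    using wreath[of id phi] phi by auto
  obtain s where s: "s \<in> supported (Y e - {e})" "\<And>i j x. x \<in> V \<Longrightarrow> s (th (i, j) x) = th (i + 1, j) x"
    using wreath[OF bs open_homeo_id[OF V]] by auto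
  obtain t where t: "t \<in> supported (Y e - {e})"
      "\<And>i j x. x \<in> V \<Longrightarrow> t (th (i, j) x) = th (i, if i = 0 then j + 1 else j) x"
    using wreath[OF bt open_homeo_id[OF V]] by auto
  have FH: "F \<in> carrier Homeo" and sH: "s \<in> carrier Homeo" and tH: "t \<in> carrier Homeo"
    using F s t supportedD(1) by blast+
  have s_pow: "(s ^^ k) (th (i, j) x) = th (i + int k, j) x" if "x \<in> V" for k i j x
    using that s(2) by (induction k) (auto simp: algebra_simps)
  have s_pow_out: "(s ^^ k) y = y" if "y \<notin> Y e - {e}" for k y
    using supportedD(2)[OF s(1) that] by (induction k) auto
  \<comment> \<open>The commutator contains w and t twice each, up to inverses, and w contains
    \<open>s ^^ k\<close> twice and F once.\<close>
  have "real k * real k \<le> real k * (4 * l s) + (2 * l F + 2 * l t)" for k :: nat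
  proof -
    define w where "w = hinv (s ^^ k) \<circ> F \<circ> (s ^^ k)"
    have skH: "s ^^ k \<in> carrier Homeo" using Homeo_funpow[OF sH] .
    have wH: "w \<in> carrier Homeo" unfolding w_def by (intro Homeo_comp Homeo_inv FH skH)
    have w: "w (th (i, j) x) = th (i, j) (phi (i + int k, j) x)" if x: "x \<in> V" for i j x
    proof -
      have y: "phi (i + int k, j) x \<in> V" using open_homeoD(7)[OF phi x] .
      show ?thesis
        using F(2)[OF x] s_pow[OF x, of k i j] s_pow[OF y, of k i j] Homeo_inv_simps(2)[OF skH]
        unfolding w_def by (metis comp_apply)
    qed
    have w_out: "w y = y" if "y \<notin> Y e - {e}" for y
      using s_pow_out[OF that, of k] supportedD(2)[OF F(1) that] Homeo_inv_simps(2)[OF skH]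
      unfolding w_def by (metis comp_apply)
    \<comment> \<open>The map t changes only column i = 0, where w acts as \<open>f k\<close> for j
      \<ge> 0 and trivially for j < 0. So w and t fail to commute only at the step from j = -1 to j
      = 0, which lands on V; there the extra \<open>f k\<close> makes up the difference.\<close>
    have "f k (t (w y)) = w (t y)" for y
    proof (cases "y \<in> Y e - {e}")
      case False
      moreover have "V \<subseteq> Y e - {e}" using pieces_subset[OF e] by (simp add: V_def)
      ultimately show ?thesis
        using w_out supportedD(2)[OF t(1)] supportedD(2)[OF f(1)] by (metis subsetD)
    next
      case True
      then obtain i j x where x: "x \<in> V" and y: "y = th (i, j) x" using cover by fastforce
      define j' where "j' = (if i = 0 then j + 1 else j)"
      have px: "phi (i + int k, j) x \<in> V" using open_homeoD(7)[OF phi x] .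
      have lhs: "f k (t (w y)) = f k (th (i, j') (phi (i + int k, j) x))"
        using w[OF x] t(2)[OF px] by (simp add: y j'_def)
      have rhs: "w (t y) = th (i, j') (phi (i + int k, j') x)"
        using w[OF x] t(2)[OF x] by (simp add: y j'_def)
      show ?thesis
      proof (cases "i = 0 \<and> j' = 0")
        case True
        then have "i = 0" "j = -1" by (auto simp: j'_def)
        then show ?thesis using True by (simp add: lhs rhs th_0) (simp add: phi_def)
      next
        case False
        have "th (i, j') z \<notin> V" if "z \<in> V" for z
        proof -
          have "W (i, j') \<inter> W (0, 0) = {}"
            using W_dis False unfolding disjoint_family_on_def by blast
          then show ?thesis using th_W[OF that, of "(i, j')"] W0 by blast
        qed
        then have "f k (th (i, j') (phi (i + int k, j) x)) = th (i, j') (phi (i + int k, j) x)"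
          using supportedD(2)[OF f(1)] px by blast
        moreover have "phi (i + int k, j) = phi (i + int k, j')"
          using False by (auto simp: phi_def j'_def)
        ultimately show ?thesis using lhs rhs by simp
      qed
    qed
    then have "f k \<circ> (t \<circ> w) = w \<circ> t" by auto
    then have "f k = (w \<circ> t) \<circ> hinv (t \<circ> w)"
      using Homeo_inv_simps(3)[OF Homeo_comp[OF tH wH]] by (metis comp_assoc comp_id)
    then have "l (f k) \<le> l (w \<circ> t) + l (hinv (t \<circ> w))"
      using length_fun_comp[OF l] Homeo_comp Homeo_inv tH wH by metis
    also have "\<dots> \<le> (l w + l t) + (l t + l w)"
      using length_fun_comp[OF l] length_fun_inv[OF l] Homeo_comp tH wH by (metis add_mono)
    finally have 1: "l (f k) \<le> 2 * l w + 2 * l t" by simp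
    have "l w \<le> l (hinv (s ^^ k)) + l F + l (s ^^ k)"
      using length_fun_comp[OF l Homeo_comp[OF Homeo_inv[OF skH] FH] skH]
        length_fun_comp[OF l Homeo_inv[OF skH] FH] unfolding w_def by linarith
    also have "\<dots> \<le> 2 * (real k * l s) + l F"
      using length_fun_inv[OF l skH] length_fun_funpow[OF l sH, of k] by simp
    finally show ?thesis using 1 f(2)[of k] by (simp add: algebra_simps)
  qed
  then show False using square_not_linearly_bounded by blast
qed

text \<open>Inside \<open>pieces e P\<close> one finds a big set A that h maps into T, the pieces of
  P and Q, such that A and its image both leave a big remainder in T. Then some g supported on T
  agrees with h on A, so that \<open>hinv g \<circ> h\<close> fixes A pointwise. Conjugating by t,
  which carries A onto all of \<open>pieces e P\<close>, gives w, which fixes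
  \<open>pieces e P\<close>.\<close>

lemma factor_through_moieties:
  assumes e: "e \<in> E" and h: "h \<in> supported (Y e)"
    and PQ: "infinite Q" "P \<inter> Q = {}" "infinite {k \<in> P. h (pt e k) \<in> pieces e (P \<union> Q)}"
  shows "\<exists>g\<in>supported (pieces e (P \<union> Q)). \<exists>t\<in>supported (pieces e (P \<union> Q)).
           \<exists>w\<in>supported (pieces e (- P)). h = g \<circ> hinv t \<circ> w \<circ> t"
proof -
  define D where "D = Y e - {e}"
  define T where "T = pieces e (P \<union> Q)"
  define I where "I = {k \<in> P. h (pt e k) \<in> T}"
  have hH: "h \<in> carrier Homeo" using supportedD(1)[OF h] .
  have inj_h: "inj h" using Homeo_bij[OF hH] by (rule bij_is_inj)
  have hD: "h x \<in> D \<longleftrightarrow> x \<in> D" for x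
    using supported_Y_fixes[OF e h] supportedD(2,4)[OF h] inj_h unfolding D_def
    by (metis Diff_iff injD singletonD singletonI)
  \<comment> \<open>Only half of I is used for A: the images of the points with index in the other
    half remain in T outside the image of A, which makes that remainder big.\<close>
  obtain I1 where I1: "I1 \<subseteq> I" "infinite I1" "infinite (I - I1)"
  proof -
    obtain a :: "nat \<Rightarrow> nat" where a: "inj a" "range a \<subseteq> I"
      using PQ(3) infinite_countable_subset unfolding I_def T_def by blast
    have "a ` {n. odd n} \<subseteq> I - a ` {n. even n}"
      using a unfolding inj_def by blast
    moreover have "infinite (a ` {n. odd n})" "infinite (a ` {n. even n})"
    proof -
      have "infinite {n::nat. odd n}" "infinite {n::nat. even n}"
        unfolding infinite_nat_iff_unbounded_le
        by (metis mem_Collect_eq le_refl le_SucI even_Suc)+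
      then show "infinite (a ` {n. odd n})" "infinite (a ` {n. even n})"
        using a(1) by (simp_all add: finite_image_iff inj_on_subset)
    qed
    ultimately show ?thesis using a(2) by (intro that[of "a ` {n. even n}"]) (auto intro: finite_subset)
  qed
  have T: "open T" "T \<subseteq> D" "D - T = pieces e (- (P \<union> Q))"
    unfolding T_def D_def pieces_Compl[OF e] using open_pieces[OF e] pieces_subset[OF e] by auto
  \<comment> \<open>Only the points \<open>pt e k\<close> are known to be sent into T, not their
    pieces, so each piece is cut down to the preimage of T.\<close>
  define A where "A = (\<Union>k\<in>I1. K e k \<inter> h -` T)"
  have A_sub: "A \<subseteq> pieces e P" using I1(1) by (auto simp: A_def I_def pieces_def)
  have A_D: "A \<subseteq> D" using A_sub pieces_subset[OF e] by (auto simp: D_def)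
  have A_open: "open A" unfolding A_def
    using K_clopen[OF e] Homeo_open_vimage[OF hH T(1)] by (intro open_UN) auto
  have "D - A = pieces e (- I1) \<union> (\<Union>k\<in>I1. K e k \<inter> h -` (D - T))"
  proof (intro equalityI subsetI)
    fix x assume x: "x \<in> D - A"
    then obtain k where "x \<in> K e k" using K_cover[OF e] by (auto simp: D_def)
    then show "x \<in> pieces e (- I1) \<union> (\<Union>k\<in>I1. K e k \<inter> h -` (D - T))"
      using x hD[of x] by (cases "k \<in> I1") (auto simp: A_def pieces_def)
  next
    fix x assume "x \<in> pieces e (- I1) \<union> (\<Union>k\<in>I1. K e k \<inter> h -` (D - T))"
    then show "x \<in> D - A"
      using K_cover[OF e] K_eq[OF e] by (auto simp: A_def pieces_def D_def)
  qed
  then have A_co: "open (D - A)"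
    using open_pieces[OF e, of "- I1"] K_clopen[OF e] Homeo_open_vimage[OF hH, of "D - T"] T(3)
      open_pieces[OF e, of "- (P \<union> Q)"]
    by (auto intro!: open_Un open_UN)
  have ptA: "pt e k \<in> A \<longleftrightarrow> k \<in> I1" if "k \<in> I" for k
    using that K_eq[OF e] pt_mem[OF e] unfolding A_def I_def by blast
  have bigA: "big e A"
  proof -
    have "pt e ` I1 \<subseteq> A \<inter> C" using ptA I1(1) pt_mem[OF e] by blast
    moreover have "infinite (pt e ` I1)" using I1(2) inj_pt[OF e] by (simp add: finite_image_iff inj_on_subset)
    ultimately have "infinite (A \<inter> C)" using finite_subset by blast
    then show ?thesis using A_D A_open A_co by (simp add: big_def D_def)
  qed
  have AT: "A \<subseteq> T" using A_sub by (auto simp: T_def pieces_def)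
  \<comment> \<open>The pieces of Q are untouched by A and supply the infinitely many points of
    C.\<close>
  have bigTA: "big e (T - A)"
  proof -
    have "open (T - A)"
    proof -
      have "T - A = T \<inter> (D - A)" using T(2) by auto
      then show ?thesis using T(1) A_co by auto
    qed
    moreover have "open (D - (T - A))"
    proof -
      have "D - (T - A) = (D - T) \<union> A" using A_D by auto
      then show ?thesis using T(3) open_pieces[OF e] A_open by auto
    qed
    moreover have "infinite ((T - A) \<inter> C)"
    proof -
      have "pieces e Q = pieces e Q - pieces e P"
        using PQ(2) pieces_Diff[OF e, of Q P] by (metis Diff_triv inf_commute)
      then have "pieces e Q \<inter> C \<subseteq> (T - A) \<inter> C" using A_sub by (auto simp: T_def pieces_Un)
      then show ?thesis using infinite_pieces_C[OF e PQ(1)] finite_subset by blast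
    qed
    ultimately show ?thesis using T(2) by (auto simp: big_def D_def)
  qed
  define B where "B = h ` A"
  have BT: "B \<subseteq> T" by (auto simp: B_def A_def)
  have bigTB: "big e (T - B)"
  proof -
    have "h ` D = D"
      using hD Homeo_bij[OF hH] by (auto simp: bij_def surj_def image_iff) (metis)
    then have "D - B = h ` (D - A)" using inj_h by (simp add: B_def image_set_diff)
    then have coB: "open (D - B)" using Homeo_open_image[OF hH A_co] by simp
    have "T - B = T \<inter> (D - B)" using T(2) by auto
    then have "open (T - B)" using T(1) coB by auto
    moreover have "open (D - (T - B))"
    proof -
      have "D - (T - B) = (D - T) \<union> B" using BT T(2) by auto
      then show ?thesis using T(3) open_pieces[OF e] Homeo_open_image[OF hH A_open] by (auto simp: B_def)
    qed
    moreover have "infinite ((T - B) \<inter> C)"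
    proof -
      have "h ` pt e ` (I - I1) \<subseteq> (T - B) \<inter> C"
      proof safe
        fix k assume k: "k \<in> I" "k \<notin> I1"
        then show "h (pt e k) \<in> T" by (simp add: I_def)
        show "h (pt e k) \<in> C" using Homeo_C[OF hH] pt_mem[OF e] by simp
        assume "h (pt e k) \<in> B"
        then have "pt e k \<in> A" using inj_h by (simp add: B_def inj_image_mem_iff)
        then show False using ptA k by blast
      qed
      moreover have "infinite (h ` pt e ` (I - I1))"
        using I1(3) inj_pt[OF e] inj_h by (simp add: finite_image_iff inj_on_subset)
      ultimately show ?thesis using finite_subset by blast
    qed
    ultimately show ?thesis using T(2) by (auto simp: big_def D_def)
  qed
  \<comment> \<open>A homeomorphism from A onto A' extends to T because the two remainders are big,
    hence homeomorphic. It is used with the restriction of h to obtain g, and with a map onto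
    \<open>pieces e P\<close> to obtain t.\<close>
  have glue: "\<exists>g\<in>supported T. \<forall>x\<in>A. g x = u x"
    if u: "open_homeo A A' u" and A': "A' \<subseteq> T" "big e (T - A')" for A' u
  proof -
    obtain v where v: "open_homeo (T - A) (T - A') v"
      using big_homeo[OF e bigTA A'(2)] by blast
    have "open_homeo (A \<union> (T - A)) (A' \<union> (T - A')) (\<lambda>x. if x \<in> A then u x else v x)"
      by (rule ex_open_homeo_Un[OF u v]) auto
    moreover have "A \<union> (T - A) = T" "A' \<union> (T - A') = T" using AT A'(1) by auto
    ultimately have "open_homeo T T (\<lambda>x. if x \<in> A then u x else v x)" by simp
    then have "(\<lambda>x. if x \<in> T then if x \<in> A then u x else v x else x) \<in> supported T"
      using T(2,3) open_pieces[OF e] by (intro extend_supported[OF e]) (auto simp: D_def)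
    then show ?thesis using AT by (intro bexI) auto
  qed
  obtain g where g: "g \<in> supported T" "\<And>x. x \<in> A \<Longrightarrow> g x = h x"
    using glue[OF Homeo_open_homeo[OF hH A_open]] BT bigTB by (auto simp: B_def)
  have "infinite P" using I1(2) I1(1) by (auto simp: I_def intro: finite_subset)
  then obtain u where u: "open_homeo A (pieces e P) u"
    using big_homeo[OF e bigA big_pieces[OF e]] by blast
  have "T - pieces e P = pieces e Q"
    using PQ(2) pieces_Diff[OF e, of "P \<union> Q" P] by (simp add: T_def Un_Diff Diff_triv inf_commute)
  then obtain t where t: "t \<in> supported T" "\<And>x. x \<in> A \<Longrightarrow> t x = u x"
    using glue[OF u] big_pieces[OF e PQ(1)] by (auto simp: T_def pieces_Un)
  have gH: "g \<in> carrier Homeo" and tH: "t \<in> carrier Homeo"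
    using g t supportedD(1) by blast+
  define w where "w = t \<circ> hinv g \<circ> h \<circ> hinv t"
  have wH: "w \<in> carrier Homeo" unfolding w_def by (intro Homeo_comp Homeo_inv gH tH hH)
  have "w x = x" if "x \<notin> pieces e (- P)" for x
  proof (cases "x \<in> D")
    case True
    then have "x \<in> pieces e P" using that pieces_Compl[OF e, of P] by (auto simp: D_def)
    then obtain a where a: "a \<in> A" "x = t a" using t(2) open_homeoD(5)[OF u] by auto
    then show ?thesis
      using g(2)[OF a(1)] Homeo_inv_simps(2)[OF tH] Homeo_inv_simps(2)[OF gH]
      unfolding w_def by (metis comp_apply)
  next
    case False
    then have "h x = x" using supported_Y_fixes[OF e h] supportedD(2)[OF h] by (auto simp: D_def)
    moreover have "t x = x" "g x = x" using False T(2) supportedD(2)[OF t(1)] supportedD(2)[OF g(1)] by auto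
    ultimately show ?thesis
      using Homeo_inv_simps(2)[OF tH] Homeo_inv_simps(2)[OF gH] unfolding w_def by (metis comp_apply)
  qed
  then have "w \<in> supported (pieces e (- P))" using wH by (simp add: supported_def)
  moreover have "h = g \<circ> hinv t \<circ> w \<circ> t"
    using Homeo_inv_simps[OF tH] Homeo_inv_simps[OF gH] by (auto simp: w_def fun_eq_iff)
  ultimately show ?thesis using g(1) t(1) unfolding T_def by blast
qed

text \<open>Three residue classes are the right number: class 0 with class 1, class 0 with class 2,
  and the complement of class 0 are all infinite and co-infinite, while the first two cover
  everything. Hence h sends infinitely many of the points with index in class 0 into one of these
  two, and that choice determines Q in the factorization.\<close>

lemma bdd_above_length_supported_Y:
  assumes e: "e \<in> E" and l: "length_fun l"
  shows "bdd_above (l ` supported (Y e))"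
proof -
  define R where "R i = {k::nat. k mod 3 = i}" for i
  have inf: "infinite (R i)" if "i < 3" for i
  proof -
    have "(\<lambda>n. 3 * n + i) ` UNIV \<subseteq> R i" using that by (auto simp: R_def)
    moreover have "infinite ((\<lambda>n::nat. 3 * n + i) ` UNIV)"
      by (subst finite_image_iff) (auto simp: inj_on_def)
    ultimately show ?thesis using finite_subset by blast
  qed
  have bdd: "bdd_above (l ` supported (pieces e J))" if "i < 3" "i' < 3" "R i \<subseteq> J" "R i' \<subseteq> - J" for J i i'
    using that inf finite_subset by (intro bdd_above_length_supported_pieces[OF e _ _ l]) blast+
  have "bdd_above (l ` supported (pieces e (R 0 \<union> R 1)))" by (rule bdd[of 0 2]) (auto simp: R_def)
  then obtain M1 where M1: "\<And>h. h \<in> supported (pieces e (R 0 \<union> R 1)) \<Longrightarrow> l h \<le> M1"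
    by (auto simp: bdd_above_def)
  have "bdd_above (l ` supported (pieces e (R 0 \<union> R 2)))" by (rule bdd[of 0 1]) (auto simp: R_def)
  then obtain M2 where M2: "\<And>h. h \<in> supported (pieces e (R 0 \<union> R 2)) \<Longrightarrow> l h \<le> M2"
    by (auto simp: bdd_above_def)
  have "bdd_above (l ` supported (pieces e (- R 0)))" by (rule bdd[of 1 0]) (auto simp: R_def)
  then obtain M3 where M3: "\<And>h. h \<in> supported (pieces e (- R 0)) \<Longrightarrow> l h \<le> M3"
    by (auto simp: bdd_above_def)
  have "l h \<le> 3 * max M1 M2 + M3" if h: "h \<in> supported (Y e)" for h
  proof -
    \<comment> \<open>The factors g, t and the inverse of t each cost at most M, and w costs at most
      M3.\<close>
    have *: "l h \<le> 3 * M + M3"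
      if j: "j = 1 \<or> j = 2" "infinite {k \<in> R 0. h (pt e k) \<in> pieces e (R 0 \<union> R j)}"
        and M: "\<And>h. h \<in> supported (pieces e (R 0 \<union> R j)) \<Longrightarrow> l h \<le> M" for j M
    proof -
      have "infinite (R j)" "R 0 \<inter> R j = {}" using inf j(1) by (auto simp: R_def)
      then obtain g t w where gtw: "g \<in> supported (pieces e (R 0 \<union> R j))"
          "t \<in> supported (pieces e (R 0 \<union> R j))" "w \<in> supported (pieces e (- R 0))"
          "h = g \<circ> hinv t \<circ> w \<circ> t"
        using factor_through_moieties[OF e h _ _ j(2)] by blast
      have H: "g \<in> carrier Homeo" "t \<in> carrier Homeo" "w \<in> carrier Homeo"
        using gtw supportedD(1) by blast+
      have "l h \<le> l (g \<circ> hinv t \<circ> w) + l t"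
        unfolding gtw(4) by (intro length_fun_comp[OF l] Homeo_comp Homeo_inv H)
      moreover have "l (g \<circ> hinv t \<circ> w) \<le> l (g \<circ> hinv t) + l w"
        by (intro length_fun_comp[OF l] Homeo_comp Homeo_inv H)
      moreover have "l (g \<circ> hinv t) \<le> l g + l (hinv t)"
        by (intro length_fun_comp[OF l] Homeo_inv H)
      ultimately show ?thesis
        using length_fun_inv[OF l H(2)] M[OF gtw(1)] M[OF gtw(2)] M3[OF gtw(3)] by linarith
    qed
    have "h (pt e k) \<in> pieces e (R 0 \<union> R 1) \<or> h (pt e k) \<in> pieces e (R 0 \<union> R 2)" for k
    proof -
      have "pt e k \<in> Y e - {e}" using pt_mem(1)[OF e, of k] K_cover[OF e] by blast
      then have "h (pt e k) \<in> Y e - {e}"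
        using supported_Y_fixes[OF e h] supportedD(4)[OF h] Homeo_bij[OF supportedD(1)[OF h]]
        by (metis Diff_iff bij_def injD singletonD singletonI)
      moreover have "(R 0 \<union> R 1) \<union> (R 0 \<union> R 2) = UNIV"
      proof -
        have "k mod 3 = 0 \<or> k mod 3 = 1 \<or> k mod 3 = 2" for k :: nat by linarith
        then show ?thesis by (auto simp only: R_def set_eq_iff Un_iff mem_Collect_eq UNIV_I)
      qed
      ultimately show ?thesis using pieces_UNIV[OF e] pieces_Un by (metis Un_iff)
    qed
    then have "R 0 \<subseteq> {k \<in> R 0. h (pt e k) \<in> pieces e (R 0 \<union> R 1)} \<union>
                     {k \<in> R 0. h (pt e k) \<in> pieces e (R 0 \<union> R 2)}" by auto
    then have "infinite {k \<in> R 0. h (pt e k) \<in> pieces e (R 0 \<union> R 1)} \<or>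
               infinite {k \<in> R 0. h (pt e k) \<in> pieces e (R 0 \<union> R 2)}"
      using inf[of 0] finite_subset finite_UnI by (metis (lifting) zero_less_numeral)
    then show ?thesis
    proof
      assume "infinite {k \<in> R 0. h (pt e k) \<in> pieces e (R 0 \<union> R 1)}"
      then show ?thesis using *[of 1 M1] M1 by fastforce
    next
      assume "infinite {k \<in> R 0. h (pt e k) \<in> pieces e (R 0 \<union> R 2)}"
      then show ?thesis using *[of 2 M2] M2 by fastforce
    qed
  qed
  then show ?thesis unfolding bdd_above_def by auto
qed

end

section \<open>Generation\<close>

lemma group_Homeo: "group (Homeo :: ('a::topological_space \<Rightarrow> 'a) monoid)"
proof (rule groupI)
  fix x y z :: "'a \<Rightarrow> 'a"
  assume x: "x \<in> carrier Homeo"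
  show "\<exists>y\<in>carrier Homeo. y \<otimes>\<^bsub>Homeo\<^esub> x = \<one>\<^bsub>Homeo\<^esub>"
    using Homeo_inv[OF x] Homeo_inv_simps(4)[OF x] by (auto simp: Homeo_def)
  show "x \<otimes>\<^bsub>Homeo\<^esub> y \<in> carrier Homeo" if "y \<in> carrier Homeo"
    using Homeo_comp[OF x that] by (simp add: Homeo_def)
qed (use Homeo_id in \<open>auto simp: Homeo_def comp_assoc\<close>)

lemma Homeo_mult: "g \<otimes>\<^bsub>Homeo\<^esub> h = g \<circ> h"
  by (simp add: Homeo_def)

lemma Homeo_one: "\<one>\<^bsub>Homeo\<^esub> = id"
  by (simp add: Homeo_def)

lemma Homeo_m_inv: "h \<in> carrier Homeo \<Longrightarrow> inv\<^bsub>Homeo\<^esub> h = hinv h"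
  using group.inv_equality[OF group_Homeo, of "hinv h" h] Homeo_inv[of h] Homeo_inv_simps(4)[of h]
  by (simp add: Homeo_mult Homeo_one)

lemma generate_Homeo_closed:
  assumes "A \<subseteq> carrier Homeo"
  shows "g \<in> generate Homeo A \<Longrightarrow> g \<in> carrier Homeo"
    and "g \<in> generate Homeo A \<Longrightarrow> h \<in> generate Homeo A \<Longrightarrow> g \<circ> h \<in> generate Homeo A"
    and "g \<in> generate Homeo A \<Longrightarrow> hinv g \<in> generate Homeo A"
    and "g \<in> generate Homeo A \<Longrightarrow> g ^^ n \<in> generate Homeo A"
proof -
  show 1: "g \<in> generate Homeo A \<Longrightarrow> g \<in> carrier Homeo" for g
    using group.generate_in_carrier[OF group_Homeo assms] .
  show 2: "g \<in> generate Homeo A \<Longrightarrow> h \<in> generate Homeo A \<Longrightarrow> g \<circ> h \<in> generate Homeo A" for g h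
    using generate.eng[of g Homeo A h] by (simp add: Homeo_mult)
  show "g \<in> generate Homeo A \<Longrightarrow> hinv g \<in> generate Homeo A"
    using group.generate_m_inv_closed[OF group_Homeo assms, of g] Homeo_m_inv[OF 1, of g] by simp
  show "g ^^ n \<in> generate Homeo A" if "g \<in> generate Homeo A"
    using that 2 generate.one[of Homeo A] by (induction n) (auto simp: Homeo_one id_def o_def)
qed

lemma length_fun_left_invariant_metric:
  assumes "left_invariant_metric Homeo d"
  shows "length_fun (d id)"
proof -
  have zero: "d x x = 0" and sym: "d x y = d y x" and tri: "d x z \<le> d x y + d y z"
    and inva: "d (g \<circ> x) (g \<circ> y) = d x y"
    if "g \<in> carrier Homeo" "x \<in> carrier Homeo" "y \<in> carrier Homeo" "z \<in> carrier Homeo" for g x y z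
    using assms that unfolding left_invariant_metric_def Homeo_mult by blast+
  have "d id (g \<circ> h) \<le> d id g + d id h" if g: "g \<in> carrier Homeo" and h: "h \<in> carrier Homeo" for g h
    using tri[OF g Homeo_id g Homeo_comp[OF g h]] inva[OF g Homeo_id h h] by simp
  moreover have "d id (hinv g) = d id g" if g: "g \<in> carrier Homeo" for g
    using inva[OF g Homeo_id Homeo_inv[OF g] g] sym[OF g g Homeo_id g] Homeo_inv_simps(3)[OF g] by simp
  ultimately show ?thesis
    using zero[OF Homeo_id Homeo_id Homeo_id Homeo_id] by (simp add: length_fun_def)
qed

lemma strongly_bounded_HomeoI:
  assumes "A \<subseteq> carrier Homeo" "\<And>l. length_fun l \<Longrightarrow> bdd_above (l ` A)"
  shows "strongly_bounded Homeo A"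
  unfolding strongly_bounded_def
proof (intro conjI allI impI assms(1))
  fix d :: "('a \<Rightarrow> 'a) \<Rightarrow> ('a \<Rightarrow> 'a) \<Rightarrow> real"
  assume d: "left_invariant_metric Homeo d"
  then have "bdd_above (d id ` A)" by (intro assms(2) length_fun_left_invariant_metric)
  then obtain M where M: "\<And>x. x \<in> A \<Longrightarrow> d id x \<le> M" by (auto simp: bdd_above_def)
  have "d x y \<le> 2 * M" if xy: "x \<in> A" "y \<in> A" for x y
  proof -
    have "x \<in> carrier Homeo" "y \<in> carrier Homeo" using xy assms(1) by auto
    then have "d x y \<le> d id x + d id y"
      using d Homeo_id unfolding left_invariant_metric_def by metis
    then show ?thesis using M[OF xy(1)] M[OF xy(2)] by simp
  qed
  then show "\<exists>M. \<forall>x\<in>A. \<forall>y\<in>A. d x y \<le> M" by blast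
qed

section \<open>Shifts and the generating set\<close>

context piece_decomposition
begin

text \<open>Hilbert's hotel: moving every piece to the next place vacates \<open>K e 0\<close>, and
  convergence of the pieces to e makes the move continuous at e.\<close>

lemma ex_shift_Y:
  assumes e: "e \<in> E"
  shows "\<exists>s. open_homeo (Y e) (Y e - K e 0) s \<and> s e = e \<and> (\<forall>k. s ` K e k = K e (Suc k))"
proof -
  have "\<forall>k. \<exists>h. open_homeo (K e k) (K e (Suc k)) h" using K_homeo[OF e e] by blast
  then obtain h where h: "\<And>k. open_homeo (K e k) (K e (Suc k)) (h k)" by metis
  have dis: "disjoint_family (\<lambda>k. K e (Suc k))"
    using K_disjoint[OF e] by (auto simp: disjoint_family_on_def)
  obtain F where F: "open_homeo (\<Union>k. K e k) (\<Union>k. K e (Suc k)) F" "\<And>k x. x \<in> K e k \<Longrightarrow> F x = h k x"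
    using ex_open_homeo_glue[OF h K_disjoint[OF e] dis] by (metis UNIV_I)
  define s where "s = F(e := e)"
  have eK: "e \<notin> K e k" for k using K_cover[OF e] by blast
  have sK: "s ` K e k = K e (Suc k)" for k
  proof -
    have "s ` K e k = h k ` K e k"
      using F(2) eK[of k] by (intro image_cong) (auto simp: s_def)
    then show ?thesis using open_homeoD(5)[OF h] by simp
  qed
  have s: "open_homeo (\<Union>k. K e k) (\<Union>k. K e (Suc k)) s"
    using eK by (intro open_homeo_cong[OF F(1)]) (auto simp: s_def)
  have Y1: "insert e (\<Union>k. K e k) = Y e" using K_cover[OF e] Y_mem[OF e] by auto
  have Y2: "insert e (\<Union>k. K e (Suc k)) = Y e - K e 0"
  proof -
    have "(\<Union>k. K e k) = K e 0 \<union> (\<Union>k. K e (Suc k))"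
      by (subst UNIV_nat_eq) auto
    moreover have "K e 0 \<inter> (\<Union>k. K e (Suc k)) = {}" using K_eq[OF e, of _ 0] by auto
    moreover have "Y e = insert e (\<Union>k. K e k)" using Y1 by simp
    ultimately show ?thesis using eK[of 0] by auto
  qed
  have "open_homeo (insert e (\<Union>k. K e k)) (insert e (\<Union>k. K e (Suc k))) s"
  proof (rule open_homeo_insert_point[OF compact_UNIV s])
    show "e \<notin> (\<Union>k. K e k)" "e \<notin> (\<Union>k. K e (Suc k))" using eK by auto
    show "s e = e" by (simp add: s_def)
  qed (unfold Y1 Y2, use Y_clopen[OF e] K_clopen[OF e] in auto)
  then have "open_homeo (Y e) (Y e - K e 0) s" unfolding Y1 Y2 .
  then show ?thesis using sK by (intro exI[of _ s]) (simp add: s_def)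
qed

text \<open>Hilbert's hotel at both ends: the push in \<open>Y e\<close> vacates
  \<open>K e 0\<close>, which receives \<open>K e' 0\<close>, and the inverse push in
  \<open>Y e'\<close> closes the gap. The result is a homeomorphism of the whole space.\<close>

lemma ex_shift:
  assumes e: "e \<in> E" and e': "e' \<in> E" and ne: "e \<noteq> e'"
  shows "\<exists>s\<in>carrier Homeo. s e = e \<and> (\<forall>k. s ` K e k = K e (Suc k)) \<and>
           (\<forall>x. x \<notin> Y e \<union> Y e' \<longrightarrow> s x = x)"
proof -
  obtain s where s: "open_homeo (Y e) (Y e - K e 0) s" "s e = e" "\<And>k. s ` K e k = K e (Suc k)"
    using ex_shift_Y[OF e] by blast
  obtain s' where s': "open_homeo (Y e') (Y e' - K e' 0) s'"
    using ex_shift_Y[OF e'] by blast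
  obtain q where q: "open_homeo (K e' 0) (K e 0) q" using K_homeo[OF e' e] by blast
  have Kin: "K e k \<subseteq> Y e" "K e' k \<subseteq> Y e'" for k
    using K_cover[OF e] K_cover[OF e'] by blast+
  have dis: "Y e \<inter> Y e' = {}" using Y_disjoint e e' ne by (auto simp: disjoint_family_on_def)
  define f1 where "f1 x = (if x \<in> Y e then s x else q x)" for x
  have f1: "open_homeo (Y e \<union> K e' 0) (Y e - K e 0 \<union> K e 0) f1"
    unfolding f1_def using Kin dis by (intro ex_open_homeo_Un[OF s(1) q]) blast+
  define f2 where "f2 x = (if x \<in> Y e \<union> K e' 0 then f1 x else inv_into (Y e') s' x)" for x
  have f2: "open_homeo (Y e \<union> K e' 0 \<union> (Y e' - K e' 0)) (Y e - K e 0 \<union> K e 0 \<union> Y e') f2"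
    unfolding f2_def using Kin dis by (intro ex_open_homeo_Un[OF f1 open_homeo_inv[OF s']]) blast+
  have eq: "Y e \<union> K e' 0 \<union> (Y e' - K e' 0) = Y e \<union> Y e'" "Y e - K e 0 \<union> K e 0 \<union> Y e' = Y e \<union> Y e'"
    using Kin by blast+
  define f3 where "f3 x = (if x \<in> Y e \<union> Y e' then f2 x else id x)" for x
  have op: "open (- (Y e \<union> Y e'))" using Y_clopen[OF e] Y_clopen[OF e'] by auto
  have "open_homeo (Y e \<union> Y e' \<union> - (Y e \<union> Y e')) (Y e \<union> Y e' \<union> - (Y e \<union> Y e')) f3"
    unfolding f3_def using f2[unfolded eq] by (intro ex_open_homeo_Un open_homeo_id op) blast+
  moreover have "Y e \<union> Y e' \<union> - (Y e \<union> Y e') = UNIV" by blast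
  ultimately have "f3 \<in> carrier Homeo" unfolding carrier_Homeo_iff by simp
  moreover have f3s: "f3 x = s x" if "x \<in> Y e" for x
    using that by (simp add: f3_def f2_def f1_def)
  moreover have "f3 ` K e k = K e (Suc k)" for k
    using f3s Kin(1) s(3)[of k] by (metis (no_types, lifting) image_cong subsetD)
  ultimately show ?thesis
    using s(2) Y_mem[OF e] by (intro bexI[of _ f3]) (auto simp: f3_def)
qed

text \<open>The image of \<open>Y e\<close> under \<open>h s\<^sup>k\<close> misses a finite number \<open>m > 0\<close> of points of \<open>C\<close> in \<open>Y e\<close>, and
  \<open>s\<^sup>m\<close> misses as many, so the two maps differ on \<open>Y e\<close> by an element of \<open>supported (Y e)\<close>.\<close>
lemma straighten_on_Y:
  assumes e: "e \<in> E" and h: "h \<in> carrier Homeo" "h e = e"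
    and s: "s \<in> carrier Homeo" "s e = e" "\<And>k. s ` K e k = K e (Suc k)"
  shows "\<exists>u\<in>supported (Y e). \<exists>m k. \<forall>x\<in>Y e. u ((s ^^ m) x) = h ((s ^^ k) x)"
proof -
  have s_pow_K: "(s ^^ n) ` K e k = K e (k + n)" for n k
  proof (induction n)
    case (Suc n)
    have "(s ^^ Suc n) ` K e k = s ` ((s ^^ n) ` K e k)" by (simp add: image_comp)
    then show ?case using Suc s(3) by simp
  qed simp
  have s_pow_e: "(s ^^ n) e = e" for n using s(2) by (induction n) auto
  have spH: "s ^^ n \<in> carrier Homeo" for n using Homeo_funpow[OF s(1)] .
  have Y_eq: "Y e = insert e (\<Union>k. K e k)" using K_cover[OF e] Y_mem[OF e] by auto
  have eK: "e \<notin> K e k" for k using K_cover[OF e] by blast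
  have tail: "(s ^^ n) ` Y e = Y e - pieces e {..<n}" for n
  proof -
    have "(s ^^ n) ` Y e = insert e (\<Union>k. K e (k + n))"
      unfolding Y_eq by (simp add: image_UN s_pow_K s_pow_e)
    also have "\<dots> = insert e (pieces e (UNIV - {..<n}))"
    proof -
      have "(\<lambda>k. k + n) ` UNIV = UNIV - {..<n}"
      proof (intro equalityI subsetI)
        fix j assume "j \<in> UNIV - {..<n}"
        then have "j = (j - n) + n" by simp
        then show "j \<in> (\<lambda>k. k + n) ` UNIV" by (rule image_eqI) simp
      qed auto
      then show ?thesis unfolding pieces_def by (metis image_image)
    qed
    also have "\<dots> = Y e - pieces e {..<n}"
    proof -
      have "e \<notin> pieces e {..<n}" using eK by (auto simp: pieces_def)
      then show ?thesis
        using pieces_UNIV[OF e] Y_mem[OF e] by (subst pieces_Diff[OF e]) auto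
    qed
    finally show ?thesis .
  qed
  obtain k0 where k0: "\<And>j. j \<ge> k0 \<Longrightarrow> K e j \<subseteq> h -` Y e"
    using eventually_K_subset[OF e Homeo_open_vimage[OF h(1) Y_clopen(1)[OF e]]] h(2) Y_mem[OF e] by auto
  \<comment> \<open>Precomposing with \<open>s ^^ k0\<close> would already bring the image of
    \<open>Y e\<close> inside \<open>Y e\<close>. One step more leaves \<open>h (pt e k0)\<close>
    uncovered, so the gap meets C, as \<open>clopen_homeo\<close> requires.\<close>
  define k where "k = Suc k0"
  define b where "b = h \<circ> (s ^^ k)"
  have bH: "b \<in> carrier Homeo" unfolding b_def by (intro Homeo_comp h spH)
  define Z where "Z = b ` Y e"
  have Z_alt: "Z = insert e (\<Union>j. h ` K e (j + k))"
  proof -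
    have "Z = h ` ((s ^^ k) ` Y e)" by (simp add: Z_def b_def image_comp)
    also have "(s ^^ k) ` Y e = insert e (\<Union>j. K e (j + k))"
      unfolding Y_eq by (simp add: image_UN s_pow_K s_pow_e)
    finally show ?thesis by (simp add: image_UN h(2))
  qed
  have ZY: "Z \<subseteq> Y e"
  proof -
    have "h ` K e (j + k) \<subseteq> Y e" for j using k0[of "j + k"] by (auto simp: k_def)
    then show ?thesis unfolding Z_alt using Y_mem[OF e] by blast
  qed
  have Z_cl: "open Z" "closed Z"
    unfolding Z_def using Homeo_open_image[OF bH] Homeo_closed_image[OF bH] Y_clopen[OF e] by auto
  have miss: "h (pt e k0) \<in> (Y e - Z) \<inter> C"
  proof -
    have p: "pt e k0 \<in> K e k0" "pt e k0 \<in> C" using pt_mem[OF e] by auto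
    have "h (pt e k0) \<in> Y e" using k0[of k0] p by auto
    moreover have "h (pt e k0) \<notin> Z"
    proof
      have inj: "inj h" using Homeo_bij[OF h(1)] by (rule bij_is_inj)
      assume "h (pt e k0) \<in> Z"
      then consider "h (pt e k0) = h e" | j where "h (pt e k0) \<in> h ` K e (j + k)"
        unfolding Z_alt h(2) by blast
      then show False
      proof cases
        case 1
        then have "pt e k0 = e" using inj by (simp add: inj_eq)
        then show False using p(1) eK[of k0] by simp
      next
        case (2 j)
        then have "pt e k0 \<in> K e (j + k)" using inj by (simp add: inj_image_mem_iff)
        then have "k0 = j + k" using K_eq[OF e p(1)] by blast
        then show False by (simp add: k_def)
      qed
    qed
    ultimately show ?thesis using Homeo_C[OF h(1)] p by simp
  qed
  have co: "open (Y e - Z)" "closed (Y e - Z)" using Z_cl Y_clopen[OF e] by auto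
  \<comment> \<open>The only point of E in \<open>Y e\<close> is e, and Z contains it as
    \<open>h e = e\<close>.\<close>
  have "(Y e - Z) \<inter> E = {}" using E_Int_Y[OF e] Z_alt by auto
  then have fin: "finite ((Y e - Z) \<inter> C)" using finite_C[OF co(2)] by blast
  define m where "m = card ((Y e - Z) \<inter> C)"
  have "card (pieces e {..<m} \<inter> C) = m"
    using inj_pt[OF e] by (simp add: pieces_C[OF e] card_image inj_on_subset)
  then obtain v0 where "open_homeo (Y e - Z) (pieces e {..<m}) v0"
    using clopen_homeo[OF co open_pieces[OF e] closed_pieces[OF e] fin, of "{..<m}"] miss m_def by auto
  then obtain v where v: "open_homeo (pieces e {..<m}) (Y e - Z) v" using open_homeo_inv by blast
  have u0: "open_homeo (Y e - pieces e {..<m}) Z (b \<circ> hinv (s ^^ m))"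
  proof -
    have "hinv (s ^^ m) ` (Y e - pieces e {..<m}) = Y e"
      using Homeo_inv_simps(2)[OF spH] by (simp add: tail[symmetric] image_comp o_def)
    then have "(b \<circ> hinv (s ^^ m)) ` (Y e - pieces e {..<m}) = Z"
      unfolding Z_def by (metis image_comp)
    moreover have "b \<circ> hinv (s ^^ m) \<in> carrier Homeo" by (intro Homeo_comp Homeo_inv bH spH)
    moreover have "open (Y e - pieces e {..<m})"
      using Y_clopen[OF e] closed_pieces[OF e, of "{..<m}"] by auto
    ultimately show ?thesis using Homeo_open_homeo by metis
  qed
  \<comment> \<open>On the image of \<open>s ^^ m\<close> the required equation dictates the values;
    on the first m pieces any homeomorphism onto the gap will do.\<close>
  define u1 where "u1 x = (if x \<in> Y e - pieces e {..<m} then (b \<circ> hinv (s ^^ m)) x else v x)" for x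
  have "open_homeo ((Y e - pieces e {..<m}) \<union> pieces e {..<m}) (Z \<union> (Y e - Z)) u1"
    unfolding u1_def by (rule ex_open_homeo_Un[OF u0 v]) auto
  moreover have "(Y e - pieces e {..<m}) \<union> pieces e {..<m} = Y e" "Z \<union> (Y e - Z) = Y e"
    using pieces_subset[OF e, of "{..<m}"] ZY by auto
  ultimately have u1: "open_homeo (Y e) (Y e) u1" by simp
  define u where "u x = (if x \<in> Y e then u1 x else x)" for x
  have "u \<in> supported (Y e)"
    unfolding u_def by (rule extend_supported_Y[OF e u1])
  moreover have "u ((s ^^ m) x) = h ((s ^^ k) x)" if x: "x \<in> Y e" for x
  proof -
    have "(s ^^ m) x \<in> Y e - pieces e {..<m}" using x tail[of m] by blast
    then show ?thesis using Homeo_inv_simps(2)[OF spH] by (simp add: u_def u1_def b_def)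
  qed
  ultimately show ?thesis by blast
qed

text \<open>Once the permutation of E is corrected, a homeomorphism is made the identity on one
  \<open>Y e\<close> after another until only \<open>Y e0\<close> is left. The correction for e
  moves points of \<open>Y e\<close> and \<open>Y e0\<close> only, so it preserves what has been
  achieved.\<close>

lemma SB_generated_Homeo: "SB_generated (Homeo :: ('a \<Rightarrow> 'a) monoid)"
proof -
  obtain e0 where e0: "e0 \<in> E" using E_nonempty by blast
  have "\<exists>s. s \<in> carrier Homeo \<and> s e = e \<and> (\<forall>k. s ` K e k = K e (Suc k)) \<and>
           (\<forall>x. x \<notin> Y e \<union> Y e0 \<longrightarrow> s x = x)" if "e \<in> E - {e0}" for e
    using ex_shift[OF _ e0, of e] that by blast
  then obtain s where s: "\<And>e. e \<in> E - {e0} \<Longrightarrow> s e \<in> carrier Homeo"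
      "\<And>e. e \<in> E - {e0} \<Longrightarrow> s e e = e" "\<And>e k. e \<in> E - {e0} \<Longrightarrow> s e ` K e k = K e (Suc k)"
      "\<And>e x. e \<in> E - {e0} \<Longrightarrow> x \<notin> Y e \<union> Y e0 \<Longrightarrow> s e x = x"
    by metis
  \<comment> \<open>The representative depends only on the restriction to E, and there are finitely
    many maps from E to E; hence R is finite.\<close>
  define rep where "rep p = (SOME g. g \<in> carrier Homeo \<and> restrict g E = p)" for p
  define R where "R = rep ` (\<lambda>g. restrict g E) ` (carrier Homeo :: ('a \<Rightarrow> 'a) set)"
  have rep: "rep (restrict g E) \<in> carrier Homeo \<and> restrict (rep (restrict g E)) E = restrict g E"
    if "g \<in> carrier Homeo" for g
    unfolding rep_def by (rule someI[of _ g]) (use that in auto)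
  have "(\<lambda>g. restrict g E) ` (carrier Homeo :: ('a \<Rightarrow> 'a) set) \<subseteq> E \<rightarrow>\<^sub>E E"
    using Homeo_E by auto
  then have finR: "finite R"
    unfolding R_def using finite_PiE[OF finite_E finite_E] by (meson finite_imageI finite_subset)
  define A where "A = (\<Union>e\<in>E. supported (Y e)) \<union> s ` (E - {e0}) \<union> R"
  have A: "A \<subseteq> carrier Homeo"
    using s(1) rep supportedD(1) unfolding A_def R_def by blast
  have "bdd_above (l ` A)" if l: "length_fun l" for l
    using bdd_above_length_supported_Y[OF _ l] finite_E finR
    by (simp add: A_def image_Un image_UN)
  then have SB: "strongly_bounded Homeo A" by (rule strongly_bounded_HomeoI[OF A])
  note gen = generate_Homeo_closed[OF A]
  have inA: "g \<in> generate Homeo A" if "g \<in> A" for g using that by (rule generate.incl)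
  \<comment> \<open>F collects the indices e other than e0 for which h may still act nontrivially on
    \<open>Y e\<close>.\<close>
  have pure: "h \<in> generate Homeo A"
    if "finite F" "F \<subseteq> E - {e0}" "h \<in> carrier Homeo" "\<And>e. e \<in> E - {e0} \<Longrightarrow> h e = e"
      "\<And>e x. e \<in> E - {e0} - F \<Longrightarrow> x \<in> Y e \<Longrightarrow> h x = x" for F h
    using that
  proof (induction F arbitrary: h rule: finite_induct)
    case empty
    have "h x = x" if x: "x \<notin> Y e0" for x
    proof -
      obtain e where "e \<in> E" "x \<in> Y e" using Y_cover by blast
      then show ?thesis using empty.prems(4)[of e x] x by blast
    qed
    then have "h \<in> supported (Y e0)" using empty.prems(2) by (simp add: supported_def)
    then show ?case using e0 by (intro inA) (auto simp: A_def)
  next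
    case (insert e F)
    then have e: "e \<in> E - {e0}" "e \<in> E" by auto
    obtain u m k where u: "u \<in> supported (Y e)"
      and eq: "\<And>x. x \<in> Y e \<Longrightarrow> u ((s e ^^ m) x) = h ((s e ^^ k) x)"
      using straighten_on_Y[OF e(2) insert.prems(2) insert.prems(3)[OF e(1)] s(1-3)[OF e(1)]] by blast
    have ug: "u \<in> generate Homeo A" and sg: "s e \<in> generate Homeo A"
      using u e unfolding A_def by (blast intro: inA[unfolded A_def])+
    define a where "a = u \<circ> (s e ^^ m)"
    define b where "b = s e ^^ k"
    have ag: "a \<in> generate Homeo A" and bg: "b \<in> generate Homeo A"
      unfolding a_def b_def using gen(2,4) ug sg by blast+
    have aH: "a \<in> carrier Homeo" and bH: "b \<in> carrier Homeo" using gen(1) ag bg by blast+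
    \<comment> \<open>On \<open>Y e\<close> the maps a and \<open>h \<circ> b\<close> agree, so this
      product is the identity there.\<close>
    define h' where "h' = hinv a \<circ> h \<circ> b"
    have h'H: "h' \<in> carrier Homeo" unfolding h'_def by (intro Homeo_comp Homeo_inv aH bH insert.prems(2))
    have h'Y: "h' x = x" if "x \<in> Y e" for x
      using eq[OF that] Homeo_inv_simps(2)[OF aH, of x] by (simp add: h'_def a_def b_def)
    have h'out: "h' x = x" if x: "x \<notin> Y e" "x \<notin> Y e0" "h x = x" for x
    proof -
      have "(s e ^^ n) x = x" for n using s(4)[OF e(1)] x by (induction n) auto
      moreover then have "a x = x" using supportedD(2)[OF u x(1)] by (simp add: a_def)
      ultimately show ?thesis
        using Homeo_inv_simps(2)[OF aH, of x] x(3) by (simp add: h'_def b_def)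
    qed
    have outside: "x \<notin> Y e0" "e' \<noteq> e \<Longrightarrow> x \<notin> Y e" if "e' \<in> E - {e0}" "x \<in> Y e'" for e' x
      using Y_disjoint that e e0 unfolding disjoint_family_on_def by blast+
    have "h' \<in> generate Homeo A"
    proof (rule insert.IH)
      show "F \<subseteq> E - {e0}" using insert.prems(1) by simp
      show "h' \<in> carrier Homeo" by (rule h'H)
      show "h' e' = e'" if e': "e' \<in> E - {e0}" for e'
      proof (cases "e' = e")
        case True
        then show ?thesis using h'Y Y_mem e(2) by simp
      next
        case False
        then show ?thesis
          using h'out[of e'] outside[OF e', of e'] Y_mem[of e'] e' insert.prems(3)[OF e'] by simp
      qed
      show "h' x = x" if e': "e' \<in> E - {e0} - F" and x: "x \<in> Y e'" for e' x
      proof (cases "e' = e")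
        case True
        then show ?thesis using h'Y x by simp
      next
        case False
        then show ?thesis
          using h'out[of x] outside[of e' x] e' x insert.prems(4)[of e' x] by simp
      qed
    qed
    moreover have "h = a \<circ> h' \<circ> hinv b"
      using Homeo_inv_simps[OF aH] Homeo_inv_simps[OF bH] by (auto simp: h'_def fun_eq_iff)
    ultimately show ?case using gen(2,3) ag bg by metis
  qed
  have "h \<in> generate Homeo A" if h: "h \<in> carrier Homeo" for h
  proof -
    define r where "r = rep (restrict h E)"
    have r: "r \<in> carrier Homeo" "\<And>e. e \<in> E \<Longrightarrow> r e = h e"
      using rep[OF h] unfolding r_def by (auto dest!: fun_cong simp: restrict_def split: if_splits)
    have rg: "r \<in> generate Homeo A" using h by (intro inA) (auto simp: A_def R_def r_def)
    have "hinv r \<circ> h \<in> generate Homeo A"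
    proof (rule pure[of "E - {e0}"])
      show "(hinv r \<circ> h) e = e" if "e \<in> E - {e0}" for e
        using r(2)[of e] Homeo_inv_simps(2)[OF r(1), of e] that by simp
    qed (use finite_E Homeo_comp Homeo_inv r h in auto)
    then have "r \<circ> (hinv r \<circ> h) \<in> generate Homeo A" using gen(2) rg by blast
    moreover have "r \<circ> (hinv r \<circ> h) = h" using Homeo_inv_simps(1)[OF r(1)] by (auto simp: fun_eq_iff)
    ultimately show ?thesis by simp
  qed
  then have "generate Homeo A = carrier Homeo" using gen(1) by blast
  then show ?thesis using SB unfolding SB_generated_def by blast
qed

end

theorem theorem6p1:
  fixes f :: "'i::wellorder \<Rightarrow> 'a::{wellorder, linorder_topology} set"
    and b :: 'i
  assumes "compact (UNIV :: 'a set)"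
    and "cb_deriv_seq f"
    and "limit_capacity_is f b"
    and "\<exists>c. wo_succ c b"
  shows "SB_generated (Homeo :: ('a \<Rightarrow> 'a) monoid)"
proof -
  obtain c where c: "wo_succ c b" using assms(4) by blast
  obtain r s where br: "wo_succ b r" and rs: "wo_succ r s" "f s = f r"
    and least: "\<And>a s. wo_succ a s \<Longrightarrow> f s = f a \<Longrightarrow> r \<le> a"
    using assms(3) unfolding limit_capacity_is_def cb_rank_is_def by blast
  have succ: "f j = {x. x islimpt f i}" if "wo_succ i j" for i j
    using assms(2) that unfolding cb_deriv_seq_def by blast
  \<comment> \<open>The least element of a nonempty \<open>f r\<close> would be isolated in it by an
    open initial segment, but the rank condition makes \<open>f r\<close> its own set of limit
    points.\<close>
  have fr: "f r = {}"
  proof (rule ccontr)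
    assume "f r \<noteq> {}"
    define m where "m = (LEAST x. x \<in> f r)"
    have m: "m \<in> f r" "\<And>x. x \<in> f r \<Longrightarrow> m \<le> x"
      using \<open>f r \<noteq> {}\<close> unfolding m_def by (auto intro: LeastI Least_le)
    then have "m islimpt f r" using succ[OF rs(1)] rs(2) by blast
    then obtain x where "x \<in> f r" "x \<in> {..m}" "x \<noteq> m"
      using open_atMost_wellorder[of m] by (metis islimptE atMost_iff order_refl)
    then show False using m(2)[of x] by auto
  qed
  \<comment> \<open>The index c exists by the successor hypothesis. It provides a derivative whose
    limit points are exactly E, so that a closed set avoiding E contains only finitely many points
    of C.\<close>
  define C where "C = f c"
  define E where "E = f b"
  have E: "E = {x. x islimpt C}" using succ[OF c] by (simp add: E_def C_def)
  have E_lim: "\<not> x islimpt E" for x using succ[OF br] fr by (auto simp: E_def)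
  have finE: "finite E" using finite_no_limpt[OF assms(1), of UNIV E] E_lim by simp
  \<comment> \<open>If E were empty, the derivatives would already be stationary from b on, against
    the minimality of the rank r.\<close>
  have neE: "E \<noteq> {}"
  proof
    assume "E = {}"
    then have "r \<le> b" using least[OF br] fr by (simp add: E_def)
    then show False using br unfolding wo_succ_def by (metis leD)
  qed
  obtain Y where Y: "\<And>e. e \<in> E \<Longrightarrow> open (Y e) \<and> closed (Y e) \<and> e \<in> Y e"
      "disjoint_family_on Y E" "(\<Union>e\<in>E. Y e) = UNIV"
    using ex_clopen_partition[OF finE neE] by blast
  have "\<exists>K :: nat \<Rightarrow> 'a set. (\<forall>k. open (K k) \<and> closed (K k) \<and> (\<exists>x. K k \<inter> C = {x})) \<and>
           disjoint_family K \<and> (\<Union>k. K k) = Y e - {e}" if e: "e \<in> E" for e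
  proof (rule ex_piece_sequence[OF assms(1)])
    show "e islimpt C" using e by (simp add: E)
    show "x = e" if "x \<in> Y e" "x islimpt C" for x
    proof -
      have "x \<in> E" using that by (simp add: E)
      then show ?thesis using Y(1,2) e that(1) unfolding disjoint_family_on_def by blast
    qed
  qed (use Y(1)[OF e] in auto)
  then obtain K :: "'a \<Rightarrow> nat \<Rightarrow> 'a set" where
    K: "\<And>e. e \<in> E \<Longrightarrow> (\<forall>k. open (K e k) \<and> closed (K e k) \<and> (\<exists>x. K e k \<inter> C = {x})) \<and>
           disjoint_family (K e) \<and> (\<Union>k. K e k) = Y e - {e}"
    by metis
  have inv: "h x \<in> C \<longleftrightarrow> x \<in> C" "h x \<in> E \<longleftrightarrow> x \<in> E" if "open_homeo S T h" "x \<in> S" for S T h x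
    using open_homeo_cb_deriv[OF assms(2) that] by (simp_all add: C_def E_def)
  interpret piece_decomposition C E Y K
  proof
    show "\<exists>h. open_homeo Z Z' h"
      if "open Z" "closed Z" "open Z'" "closed Z'" "finite (Z \<inter> C)" "Z \<inter> C \<noteq> {}"
        "card (Z' \<inter> C) = card (Z \<inter> C)" for Z Z'
      by (rule ex_open_homeo_card[where C = C]) (use assms(1) inv(1) that in auto)
    show "finite (Z \<inter> C)" if "closed Z" "Z \<inter> E = {}" for Z
      using that by (intro finite_no_limpt[OF assms(1)]) (auto simp: E)
  qed (use assms(1) inv finE neE Y K in \<open>simp_all add: carrier_Homeo_iff\<close>)
  show ?thesis by (rule SB_generated_Homeo)
qed

end
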